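(* Let $E\subset\mathbb{R}^4$ be a totally irrational $2$-dimensional plane which is characterized by its subperiods $p_0,p_1,p_2,p_3$ and admits a fine projection $\pi:\mathbb{R}^4\to\mathbb{R}^2$. Then the FP-tileset obtained from $E$ and $\pi$ is aperiodic: the plane can be tiled by its decorated tiles (with the Ammann bar rule), but no such tiling is periodic.
   Context: Tilings by parallelograms: fix pairwise non-collinear $v_0,\dots,v_3\in\mathbb{R}^2$ and prototiles $T_{ij}=\{\lambda v_i+\mu v_j: 0\le\lambda,\mu\le 1\}$; a tiling uses translates only (no rotations or reflections), and is edge-to-edge (two tiles meet in the empty set, a vertex, or a whole edge). Such a tiling lifts (uniquely up to the choice of an initial vertex) to a stepped $2$-dimensional surface in $\mathbb{R}^4$: a chosen vertex goes to the origin, a tile $T_{ij}$ goes to a $2$-face of a unit hypercube of $\mathbb{Z}^4$ spanned by $e_i,e_j$ (standard basis), and tiles adjacent along an edge $v_i$ go to faces adjacent along an edge $e_i$. The tiling is planar with slope $E$ (a $2$-plane) if its lift lies in $E+[0,t]^4$ for some $t\ge1$. Canonical cut and project ($4\to2$) tiling with slope $E$: for an affine $2$-plane $E$ with $E\cap\mathbb{Z}^4=\emptyset$, take all $2$-faces of the integer lattice $\mathbb{Z}^4$ lying in $E+[0,1]^4$ and map them by a linear map $\pi:\mathbb{R}^4\to\mathbb{R}^2$; $\pi$ is valid if the images form a tiling of $\mathbb{R}^2$. The $i$-shadow of a tiling is the image of its lift under the orthogonal projection $\omega_i$ onto $\mathrm{span}\{e_j: j\ne i\}\cong\mathbb{R}^3$.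 An $i$-subperiod of a $4\to2$ tiling is a prime (integer) period of its $i$-shadow; a subperiod $p_i$ of the slope $E$ is a vector of $E$ whose image $\omega_i(p_i)$ is an $i$-subperiod (so $p_i$ has integer coordinates in all positions $j\neq i$). $E$ is characterized by its subperiods if it has subperiods $p_0,\dots,p_3$ and only finitely many $2$-planes have the same subperiods (same integer coordinates). A fine projection for $E$ is a valid projection $\pi$ such that $\pi(p_i)$ and $\pi(e_i)$ are collinear for every $i\in\{0,1,2,3\}$. $E$ is totally irrational if it contains no rational line. FP-method: given such $E$ (irrational, characterized by subperiods) and a fine projection $\pi$, take a $4\to2$ tiling with slope $E$ obtained via $\pi$, draw through every vertex the four lines directed by $\pi(p_0),\dots,\pi(p_3)$; each tile thus carries segments (Ammann segments); the set of all decorated tiles up to translation is the FP-tileset. A tiling by an FP-tileset means an edge-to-edge tiling by translates of these decorated tiles such that every Ammann segment is continued on adjacent tiles so that the segments form full straight lines (Ammann bar rule). *)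

theory Defs
  imports "HOL-Analysis.Analysis"
begin

section \<open>Canonical cut and project tilings\<close>

definition integer_lattice :: "(real^4) set" where
  "integer_lattice = {x. \<forall>k. x $ k \<in> \<int>}"

definition unit_cube :: "(real^4) set" where
  "unit_cube = {x. \<forall>k. 0 \<le> x $ k \<and> x $ k \<le> 1}"

definition two_face :: "real^4 \<Rightarrow> 4 \<Rightarrow> 4 \<Rightarrow> (real^4) set" where
  "two_face x i j =
     {x + a *\<^sub>R axis i 1 + b *\<^sub>R axis j 1 | a b. 0 \<le> a \<and> a \<le> 1 \<and> 0 \<le> b \<and> b \<le> 1}"

definition selected_faces :: "(real^4) set \<Rightarrow> (real^4) set set" where
  "selected_faces F =
     {two_face x i j | x i j. x \<in> integer_lattice \<and> i \<noteq> j \<and>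
        two_face x i j \<subseteq> {y + c | y c. y \<in> F \<and> c \<in> unit_cube}}"

text \<open>Tiles are closed subsets of the plane, and a tiling is the set of its tiles. In all uses below
  the tiles are parallelograms, whose vertices and edges are their extreme points and their
  one-dimensional faces.\<close>

definition edge_to_edge :: "(real^2) set \<Rightarrow> (real^2) set \<Rightarrow> bool" where
  "edge_to_edge A B \<longleftrightarrow>
     A \<inter> B = {} \<or>
     (\<exists>x. A \<inter> B = {x} \<and> x extreme_point_of A \<and> x extreme_point_of B) \<or>
     (A \<inter> B edge_of A \<and> A \<inter> B edge_of B)"

definition plane_tiling :: "(real^2) set set \<Rightarrow> bool" where
  "plane_tiling \<T> \<longleftrightarrow> \<Union>\<T> = UNIV \<and> (\<forall>A\<in>\<T>. \<forall>B\<in>\<T>. A \<noteq> B \<longrightarrow> edge_to_edge A B)"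

definition projected_tiles :: "(real^4) set \<Rightarrow> (real^4 \<Rightarrow> real^2) \<Rightarrow> (real^2) set set" where
  "projected_tiles F \<pi> = (\<lambda>f. \<pi> ` f) ` selected_faces F"

text \<open>Here \<open>F\<close> is an affine plane. Injectivity says that no tile is covered twice, which a set of
  tiles cannot express by itself.\<close>

definition projects_to_tiling :: "(real^4) set \<Rightarrow> (real^4 \<Rightarrow> real^2) \<Rightarrow> bool" where
  "projects_to_tiling F \<pi> \<longleftrightarrow>
     F \<inter> integer_lattice = {} \<and>
     inj_on (\<lambda>f. \<pi> ` f) (selected_faces F) \<and>
     plane_tiling (projected_tiles F \<pi>)"

text \<open>The slope \<open>E\<close> is a linear plane; the tilings with slope \<open>E\<close> come from the affine planes
  parallel to \<open>E\<close>.\<close>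

definition cut_and_project_tilings :: "(real^4) set \<Rightarrow> (real^4 \<Rightarrow> real^2) \<Rightarrow> (real^2) set set set" where
  "cut_and_project_tilings E \<pi> =
     {projected_tiles ((+) s ` E) \<pi> | s. projects_to_tiling ((+) s ` E) \<pi>}"

definition valid_projection :: "(real^4) set \<Rightarrow> (real^4 \<Rightarrow> real^2) \<Rightarrow> bool" where
  "valid_projection E \<pi> \<longleftrightarrow>
     linear \<pi> \<and>
     (\<forall>i j. i \<noteq> j \<longrightarrow> \<not> collinear {0, \<pi> (axis i 1), \<pi> (axis j 1)}) \<and>
     cut_and_project_tilings E \<pi> \<noteq> {}"

section \<open>Shadows and subperiods\<close>

definition two_plane :: "(real^4) set \<Rightarrow> bool" where
  "two_plane E \<longleftrightarrow> subspace E \<and> dim E = 2"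

definition totally_irrational :: "(real^4) set \<Rightarrow> bool" where
  "totally_irrational E \<longleftrightarrow> \<not> (\<exists>v\<in>E. v \<noteq> 0 \<and> (\<forall>k. v $ k \<in> \<rat>))"

definition omit_coord :: "4 \<Rightarrow> real^4 \<Rightarrow> real^4" where
  "omit_coord i x = (\<chi> k. if k = i then 0 else x $ k)"

text \<open>The lift of a cut and project tiling is the union of the selected faces; the choice of the
  initial vertex only translates it by a lattice vector, which does not affect periods.\<close>

definition shadow :: "4 \<Rightarrow> (real^4) set \<Rightarrow> (real^4) set" where
  "shadow i F = omit_coord i ` \<Union>(selected_faces F)"

definition prime_period :: "(real^4) set \<Rightarrow> real^4 \<Rightarrow> bool" where
  "prime_period S q \<longleftrightarrow>
     (+) q ` S = S \<and> q \<in> integer_lattice \<and> Gcd (range (\<lambda>k. \<lfloor>q $ k\<rfloor>)) = 1"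

definition subperiod :: "(real^4) set \<Rightarrow> 4 \<Rightarrow> real^4 \<Rightarrow> bool" where
  "subperiod E i p \<longleftrightarrow>
     p \<in> E \<and>
     (\<forall>s. ((+) s ` E) \<inter> integer_lattice = {} \<longrightarrow>
        prime_period (shadow i ((+) s ` E)) (omit_coord i p))"

definition characterized_by_subperiods :: "(real^4) set \<Rightarrow> (4 \<Rightarrow> real^4) \<Rightarrow> bool" where
  "characterized_by_subperiods E p \<longleftrightarrow>
     (\<forall>i. subperiod E i (p i)) \<and>
     finite {E'. two_plane E' \<and>
       (\<exists>p'. \<forall>i. subperiod E' i (p' i) \<and> omit_coord i (p' i) = omit_coord i (p i))}"

definition fine_projection :: "(real^4) set \<Rightarrow> (4 \<Rightarrow> real^4) \<Rightarrow> (real^4 \<Rightarrow> real^2) \<Rightarrow> bool" where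
  "fine_projection E p \<pi> \<longleftrightarrow>
     valid_projection E \<pi> \<and> (\<forall>i. collinear {0, \<pi> (p i), \<pi> (axis i 1)})"

section \<open>Decorated tiles and Ammann bars\<close>

text \<open>A decorated tile is a tile together with the set of segments drawn on it.\<close>

type_synonym decorated_tile = "(real^2) set \<times> (real^2) set set"

definition translate_decorated :: "real^2 \<Rightarrow> decorated_tile \<Rightarrow> decorated_tile" where
  "translate_decorated t A = ((+) t ` fst A, (\<lambda>S. (+) t ` S) ` snd A)"

definition tiling_vertices :: "(real^2) set set \<Rightarrow> (real^2) set" where
  "tiling_vertices \<T> = {x. \<exists>T\<in>\<T>. x extreme_point_of T}"

definition vertex_lines :: "(4 \<Rightarrow> real^2) \<Rightarrow> (real^2) set set \<Rightarrow> (real^2) set set" where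
  "vertex_lines d \<T> = {{x + t *\<^sub>R d i | t. True} | x i. x \<in> tiling_vertices \<T>}"

text \<open>A line that meets a tile in a single point (necessarily a vertex) leaves no segment on it,
  whereas a line running along an edge does.\<close>

definition decorate :: "(4 \<Rightarrow> real^2) \<Rightarrow> (real^2) set set \<Rightarrow> (real^2) set \<Rightarrow> decorated_tile" where
  "decorate d \<T> T = (T, {L \<inter> T | L. L \<in> vertex_lines d \<T> \<and> \<not> (\<exists>x. L \<inter> T \<subseteq> {x})})"

text \<open>The tileset matters only up to translation, since tilings use arbitrary translates of its
  elements.\<close>

definition FP_tileset ::
    "(4 \<Rightarrow> real^4) \<Rightarrow> (real^4 \<Rightarrow> real^2) \<Rightarrow> (real^2) set set \<Rightarrow> decorated_tile set" where
  "FP_tileset p \<pi> \<T> = decorate (\<lambda>i. \<pi> (p i)) \<T> ` \<T>"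

text \<open>Each segment extends to a full straight line made up of segments of the tiling.\<close>

definition ammann_bar_rule :: "decorated_tile set \<Rightarrow> bool" where
  "ammann_bar_rule \<D> \<longleftrightarrow>
     (\<forall>A\<in>\<D>. \<forall>S\<in>snd A.
        affine hull S = \<Union>{S'. (\<exists>B\<in>\<D>. S' \<in> snd B) \<and> S' \<subseteq> affine hull S})"

definition decorated_tiling :: "decorated_tile set \<Rightarrow> decorated_tile set \<Rightarrow> bool" where
  "decorated_tiling X \<D> \<longleftrightarrow>
     (\<forall>A\<in>\<D>. \<exists>B\<in>X. \<exists>t. A = translate_decorated t B) \<and>
     inj_on fst \<D> \<and>
     plane_tiling (fst ` \<D>) \<and>
     ammann_bar_rule \<D>"

definition periodic :: "decorated_tile set \<Rightarrow> bool" where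
  "periodic \<D> \<longleftrightarrow> (\<exists>t. t \<noteq> 0 \<and> translate_decorated t ` \<D> = \<D>)"

definition aperiodic_tileset :: "decorated_tile set \<Rightarrow> bool" where
  "aperiodic_tileset X \<longleftrightarrow>
     (\<exists>\<D>. decorated_tiling X \<D>) \<and> (\<forall>\<D>. decorated_tiling X \<D> \<longrightarrow> \<not> periodic \<D>)"

end

theory Submission
  imports Defs
begin

text \<open>
  Write \<open>dir i = \<pi> (p i)\<close> and \<open>\<pi> (e\<^sub>i) = \<kappa> i dir i\<close>. The vectors
  \<open>kernel_vec i = p i - e\<^sub>i / \<kappa> i\<close> lie in the kernel of \<open>\<pi>\<close>, which is a complement of \<open>E\<close>. Every
  linear map \<open>g\<close> with \<open>g (dir i) \<in> \<real> kernel_vec i\<close> for all \<open>i\<close> yields the pencil of planes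
  \<open>{v + s g (\<pi> v) | v \<in> E}\<close>; for all but finitely many \<open>s\<close> they have the subperiods of \<open>E\<close>, so \<open>g = 0\<close>
  by finiteness. A consequence is that \<open>\<pi>\<close> is injective on \<open>\<int>\<^sup>4\<close> and that a lattice vector projected
  to a multiple of \<open>dir i\<close> lies in the span of \<open>p i\<close> and \<open>e\<^sub>i\<close>.

  Hence the vertices of any tiling by the decorated tiles have well-defined lattice coordinates, and
  along an Ammann bar of direction \<open>dir i\<close> the projection \<open>\<psi>\<close> of these coordinates to the kernel
  along \<open>E\<close> moves within bounded distance of the line \<open>\<real> kernel_vec i\<close>. A period of the tiling lifts
  to a nonzero lattice vector, which is not in \<open>E\<close>. Comparing the bars through one vertex with their
  translates by multiples of the period shows that the projected coordinates are linear up to a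
  bounded error, with a nonzero linear part \<open>g\<close> as above, a contradiction.
\<close>

section \<open>Lattice, faces and coordinates\<close>

lemma UNIV_4_distinct: "distinct [a, b, c, d :: 4] \<Longrightarrow> UNIV = {a, b, c, d}"
  by (rule sym, rule card_subset_eq) auto

lemma all_4_distinct:
  assumes "distinct [a, b, c, d :: 4]"
  shows "(\<forall>k. P k) \<longleftrightarrow> P a \<and> P b \<and> P c \<and> P d"
  using UNIV_4_distinct[OF assms] by (metis UNIV_I empty_iff insert_iff)

lemma obtain_distinct_4:
  fixes a b :: 4
  assumes "a \<noteq> b"
  obtains c d where "distinct [a, b, c, d]"
proof -
  have "card (UNIV - {a, b}) = 2"
    using assms by (subst card_Diff_subset) auto
  then obtain c d where "UNIV - {a, b} = {c, d}" "c \<noteq> d"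
    by (auto simp: card_2_iff)
  then show ?thesis using assms by (intro that[of c d]) auto
qed

lemma obtain_fourth_distinct:
  fixes a b c :: 4
  assumes "distinct [a, b, c]"
  obtains d where "distinct [a, b, c, d]"
proof -
  have "a \<noteq> b" using assms by simp
  then obtain d e where "distinct [a, b, d, e]" by (rule obtain_distinct_4)
  then show ?thesis
    using assms that[of d] that[of e] by (cases "c = d") auto
qed

lemma integer_lattice_add: "x \<in> integer_lattice \<Longrightarrow> y \<in> integer_lattice \<Longrightarrow> x + y \<in> integer_lattice"
  and integer_lattice_diff: "x \<in> integer_lattice \<Longrightarrow> y \<in> integer_lattice \<Longrightarrow> x - y \<in> integer_lattice"
  and integer_lattice_minus: "x \<in> integer_lattice \<Longrightarrow> - x \<in> integer_lattice"
  and integer_lattice_scale: "r \<in> \<int> \<Longrightarrow> x \<in> integer_lattice \<Longrightarrow> r *\<^sub>R x \<in> integer_lattice"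
  and integer_lattice_axis: "axis k 1 \<in> integer_lattice"
  and integer_lattice_zero: "0 \<in> integer_lattice"
  by (auto simp: integer_lattice_def axis_def)

lemma linear_omit_coord: "linear (omit_coord i)"
  by (rule linearI) (simp_all add: omit_coord_def vec_eq_iff)

lemma omit_coord_nth: "omit_coord i x $ k = (if k = i then 0 else x $ k)"
  by (simp add: omit_coord_def)

lemma omit_coord_eq: "omit_coord i x = x - x $ i *\<^sub>R axis i 1"
  by (simp add: omit_coord_def vec_eq_iff axis_def)

lemma omit_coord_axis: "omit_coord i (axis i 1) = 0"
  by (simp add: omit_coord_def vec_eq_iff axis_def)

lemma two_faceI:
  "\<alpha> \<in> {0..1} \<Longrightarrow> \<beta> \<in> {0..1} \<Longrightarrow> x + \<alpha> *\<^sub>R axis a 1 + \<beta> *\<^sub>R axis b 1 \<in> two_face x a b"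
  unfolding two_face_def by auto

lemma two_faceE:
  assumes "z \<in> two_face x a b"
  obtains \<alpha> \<beta> where "\<alpha> \<in> {0..1}" "\<beta> \<in> {0..1}" "z = x + \<alpha> *\<^sub>R axis a 1 + \<beta> *\<^sub>R axis b 1"
  using assms unfolding two_face_def by auto

lemma two_face_image:
  "two_face x a b = (\<lambda>(\<alpha>, \<beta>). x + \<alpha> *\<^sub>R axis a 1 + \<beta> *\<^sub>R axis b 1) ` ({0..1} \<times> {0..1})"
  by (force intro: two_faceI elim: two_faceE)

lemma two_face_commute: "two_face x a b = two_face x b a"
  unfolding two_face_image
  by (subst product_swap[symmetric]) (simp add: image_image case_prod_unfold add_ac)

lemma two_face_translate: "two_face (x + y) a b = (+) x ` two_face y a b"
  unfolding two_face_image image_image by (simp add: case_prod_unfold add.assoc)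

definition face_corners :: "real^4 \<Rightarrow> 4 \<Rightarrow> 4 \<Rightarrow> (real^4) set" where
  "face_corners x a b = {x, x + axis b 1, x + axis a 1, x + (axis a 1 + axis b 1)}"

lemma two_face_eq_convex_hull: "two_face x a b = convex hull face_corners x a b"
proof -
  let ?f = "\<lambda>(\<alpha>, \<beta>). \<alpha> *\<^sub>R axis a 1 + \<beta> *\<^sub>R axis b (1::real)"
  have "linear ?f"
    by (rule linearI) (auto simp: algebra_simps)
  have "two_face x a b = (+) x ` ?f ` ({0..1} \<times> {0..1})"
    unfolding two_face_image image_image by (simp add: case_prod_unfold add.assoc)
  also have "{0..1::real} \<times> {0..1::real} = convex hull ({0, 1} \<times> {0, 1})"
    by (simp only: convex_hull_Times segment_convex_hull[symmetric] closed_segment_eq_real_ivl) simp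
  also have "(+) x ` ?f ` \<dots> = convex hull ((+) x ` ?f ` ({0, 1} \<times> {0, 1}))"
    unfolding convex_hull_linear_image[OF \<open>linear ?f\<close>] convex_hull_translation ..
  also have "(+) x ` ?f ` ({0, 1} \<times> {0, 1}) = face_corners x a b"
    by (simp add: face_corners_def)
  finally show ?thesis .
qed

lemma face_corners_subset_two_face: "face_corners x a b \<subseteq> two_face x a b"
  unfolding two_face_eq_convex_hull by (rule hull_subset)

lemma face_corners_integral: "x \<in> integer_lattice \<Longrightarrow> face_corners x a b \<subseteq> integer_lattice"
  by (simp add: face_corners_def integer_lattice_add integer_lattice_axis)

lemma norm_face_corners_diff_le:
  assumes "m \<in> face_corners x a b" "n \<in> face_corners x a b"
  shows "norm (m - n) \<le> 4"
proof -
  have "norm (axis a 1 + axis b (1::real)) \<le> 2"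
    by (rule norm_triangle_le) simp
  then have "norm (v - x) \<le> 2" if "v \<in> face_corners x a b" for v
    using that by (auto simp: face_corners_def)
  from add_mono[OF this[OF assms(1)] this[OF assms(2)]] show ?thesis
    using norm_triangle_ineq4[of "m - x" "n - x"] by simp
qed

section \<open>Shadows of cut and project tilings\<close>

definition cube_thickening :: "(real^4) set \<Rightarrow> (real^4) set" where
  "cube_thickening F = {y + c | y c. y \<in> F \<and> c \<in> unit_cube}"

lemma selected_faces_eq:
  "selected_faces F =
    {two_face x a b | x a b. x \<in> integer_lattice \<and> a \<noteq> b \<and> two_face x a b \<subseteq> cube_thickening F}"
  unfolding selected_faces_def cube_thickening_def ..

text \<open>The union of the faces of \<open>\<int>\<^sup>3\<close> (the \<open>i\<close>-th coordinate being omitted) that lie in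
  \<open>{y. \<nu> \<bullet> y = h} + [0, 1]\<^sup>3\<close>. For the points \<open>y\<close> of this slab, \<open>\<nu> \<bullet> y - h\<close> is in
  \<open>[0, \<nu>\<^sub>a] + [0, \<nu>\<^sub>b] + [0, \<nu>\<^sub>c]\<close>; a face spanned by \<open>e\<^sub>a\<close> and \<open>e\<^sub>b\<close> already uses up the first two
  segments, so its base point \<open>x\<close> has \<open>\<nu> \<bullet> x - h\<close> in the third.\<close>

definition stepped_surface :: "real^4 \<Rightarrow> real \<Rightarrow> 4 \<Rightarrow> (real^4) set" where
  "stepped_surface \<nu> h i = \<Union>{omit_coord i ` two_face x a b | x a b c.
     x \<in> integer_lattice \<and> distinct [a, b, c, i] \<and> \<nu> \<bullet> x - h \<in> closed_segment 0 (\<nu> $ c)}"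

lemma stepped_surface_translate_subset:
  assumes "q \<in> integer_lattice" "\<nu> \<bullet> q = 0"
  shows "(+) (omit_coord i q) ` stepped_surface \<nu> h i \<subseteq> stepped_surface \<nu> h i"
proof
  fix y assume "y \<in> (+) (omit_coord i q) ` stepped_surface \<nu> h i"
  then obtain x a b c z where x: "x \<in> integer_lattice" "distinct [a, b, c, i]"
    "\<nu> \<bullet> x - h \<in> closed_segment 0 (\<nu> $ c)" and z: "z \<in> two_face x a b"
    and y: "y = omit_coord i q + omit_coord i z"
    unfolding stepped_surface_def by blast
  have "q + z \<in> two_face (q + x) a b"
    using z by (simp add: two_face_translate)
  then have "y \<in> omit_coord i ` two_face (q + x) a b"
    unfolding y linear_add[OF linear_omit_coord, symmetric] by (rule imageI)
  moreover have "q + x \<in> integer_lattice" "\<nu> \<bullet> (q + x) - h \<in> closed_segment 0 (\<nu> $ c)"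
    using assms x by (simp_all add: integer_lattice_add inner_add_right)
  ultimately show "y \<in> stepped_surface \<nu> h i"
    using x(2) unfolding stepped_surface_def by blast
qed

lemma stepped_surface_translate:
  assumes "q \<in> integer_lattice" "\<nu> \<bullet> q = 0"
  shows "(+) (omit_coord i q) ` stepped_surface \<nu> h i = stepped_surface \<nu> h i"
proof
  let ?S = "stepped_surface \<nu> h i"
  have "(+) (- omit_coord i q) ` ?S \<subseteq> ?S"
    using stepped_surface_translate_subset[of "- q" \<nu> i h] assms
    by (simp add: integer_lattice_minus linear_neg[OF linear_omit_coord])
  then have "(+) (omit_coord i q) ` (+) (- omit_coord i q) ` ?S \<subseteq> (+) (omit_coord i q) ` ?S"
    by (rule image_mono)
  then show "?S \<subseteq> (+) (omit_coord i q) ` ?S" by (simp add: image_image)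
qed (rule stepped_surface_translate_subset[OF assms])

lemma closed_segment_0_real: "closed_segment 0 (m :: real) = {min 0 m..max 0 m}"
  by (simp add: closed_segment_eq_real_ivl min_def max_def)

lemma scale_between_min_max:
  fixes u m :: real
  assumes "0 \<le> u" "u \<le> 1"
  shows "min 0 m \<le> u * m" "u * m \<le> max 0 m"
proof -
  have "u * m \<in> closed_segment 0 m"
    using assms by (auto simp: in_segment)
  then show "min 0 m \<le> u * m" "u * m \<le> max 0 m"
    by (simp_all add: closed_segment_0_real)
qed

lemma sum_of_segments_covered:
  fixes m n t :: real
  assumes "min 0 m + min 0 n \<le> t" "t \<le> max 0 m + max 0 n"
  obtains \<epsilon> where "\<epsilon> \<in> {0, 1}" "t - \<epsilon> * n \<in> closed_segment 0 m \<or> t - \<epsilon> * m \<in> closed_segment 0 n"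
proof -
  have "t \<in> closed_segment 0 m \<or> t \<in> closed_segment 0 n \<or>
    t - n \<in> closed_segment 0 m \<or> t - m \<in> closed_segment 0 n"
    using assms by (cases "0 \<le> m"; cases "0 \<le> n"; auto simp: closed_segment_0_real)
  then show ?thesis using that[of 0] that[of 1] by auto
qed

lemma omit_coord_edge_subset:
  assumes "\<epsilon> \<in> {0, 1}"
  shows "omit_coord i ` two_face x i b \<subseteq> omit_coord i ` two_face (x - \<epsilon> *\<^sub>R axis a 1) b a"
proof clarify
  fix z assume "z \<in> two_face x i b"
  then obtain \<alpha> \<beta> where \<beta>: "\<beta> \<in> {0..1}" and z: "z = x + \<alpha> *\<^sub>R axis i 1 + \<beta> *\<^sub>R axis b 1"
    by (rule two_faceE)
  have "x - \<epsilon> *\<^sub>R axis a 1 + \<beta> *\<^sub>R axis b 1 + \<epsilon> *\<^sub>R axis a 1 \<in> two_face (x - \<epsilon> *\<^sub>R axis a 1) b a"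
    using assms \<beta> by (intro two_faceI) auto
  moreover have "omit_coord i z = omit_coord i (x - \<epsilon> *\<^sub>R axis a 1 + \<beta> *\<^sub>R axis b 1 + \<epsilon> *\<^sub>R axis a 1)"
    by (simp add: z linear_add[OF linear_omit_coord] linear_scale[OF linear_omit_coord]
        omit_coord_axis)
  ultimately show "omit_coord i z \<in> omit_coord i ` two_face (x - \<epsilon> *\<^sub>R axis a 1) b a" by blast
qed

lemma omit_coord_two_face_shift:
  "omit_coord i ` two_face (x + r *\<^sub>R axis i 1) a b = omit_coord i ` two_face x a b"
  unfolding add.commute[of x] two_face_translate image_image
  by (simp add: linear_add[OF linear_omit_coord] linear_scale[OF linear_omit_coord] omit_coord_axis)

locale hyperplane_cylinder =
  fixes F :: "(real^4) set" and i :: 4 and \<nu> :: "real^4" and h :: real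
  assumes cylinder: "\<nu> \<bullet> v = h \<longleftrightarrow> (\<exists>r. v + r *\<^sub>R axis i 1 \<in> F)"
    and normal_nth: "\<nu> $ i = 0"
begin

lemma thickening_height:
  assumes "y \<in> cube_thickening F"
  shows "(\<Sum>k\<in>UNIV. min 0 (\<nu> $ k)) \<le> \<nu> \<bullet> y - h" "\<nu> \<bullet> y - h \<le> (\<Sum>k\<in>UNIV. max 0 (\<nu> $ k))"
proof -
  obtain z u where y: "y = z + u" "z \<in> F" and u: "\<And>k. 0 \<le> u $ k" "\<And>k. u $ k \<le> 1"
    using assms unfolding cube_thickening_def unit_cube_def by blast
  have "\<nu> \<bullet> z = h"
    unfolding cylinder using y(2) by (intro exI[of _ 0]) simp
  then have "\<nu> \<bullet> y - h = (\<Sum>k\<in>UNIV. u $ k * \<nu> $ k)"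
    by (simp add: y(1) inner_add_right) (simp add: inner_vec_def mult.commute)
  then show "(\<Sum>k\<in>UNIV. min 0 (\<nu> $ k)) \<le> \<nu> \<bullet> y - h" "\<nu> \<bullet> y - h \<le> (\<Sum>k\<in>UNIV. max 0 (\<nu> $ k))"
    using scale_between_min_max[OF u] by (simp_all add: sum_mono)
qed

lemma face_height:
  assumes "two_face x a b \<subseteq> cube_thickening F" and "distinct [a, b, c, d]"
  shows "min 0 (\<nu> $ c) + min 0 (\<nu> $ d) \<le> \<nu> \<bullet> x - h" "\<nu> \<bullet> x - h \<le> max 0 (\<nu> $ c) + max 0 (\<nu> $ d)"
proof -
  have sums: "(\<Sum>k\<in>UNIV. f k) = f a + f b + f c + f d" for f :: "4 \<Rightarrow> real"
    using assms(2) by (simp add: UNIV_4_distinct[OF assms(2)])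
  have corner: "x + \<alpha> *\<^sub>R axis a 1 + \<beta> *\<^sub>R axis b 1 \<in> cube_thickening F"
    if "\<alpha> \<in> {0, 1}" "\<beta> \<in> {0, 1}" for \<alpha> \<beta>
    using assms(1) that by (intro subsetD[OF assms(1)] two_faceI) auto
  have height: "\<nu> \<bullet> (x + \<alpha> *\<^sub>R axis a 1 + \<beta> *\<^sub>R axis b 1) = \<nu> \<bullet> x + \<alpha> * \<nu> $ a + \<beta> * \<nu> $ b" for \<alpha> \<beta>
    by (simp add: inner_add_right inner_axis)
  have "\<exists>\<alpha>\<in>{0, 1}. \<alpha> * r = min 0 r" "\<exists>\<alpha>\<in>{0, 1}. \<alpha> * r = max 0 r" for r :: real
    by (auto simp: min_def max_def)
  then obtain lo hi :: "real \<Rightarrow> real" where "\<And>r. lo r \<in> {0, 1}" "\<And>r. lo r * r = min 0 r"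
    and "\<And>r. hi r \<in> {0, 1}" "\<And>r. hi r * r = max 0 r" by metis
  then show "min 0 (\<nu> $ c) + min 0 (\<nu> $ d) \<le> \<nu> \<bullet> x - h" "\<nu> \<bullet> x - h \<le> max 0 (\<nu> $ c) + max 0 (\<nu> $ d)"
    using thickening_height(1)[OF corner[of "lo (\<nu> $ a)" "lo (\<nu> $ b)"]]
      thickening_height(2)[OF corner[of "hi (\<nu> $ a)" "hi (\<nu> $ b)"]]
    unfolding height sums by simp_all
qed

lemma selected_face_in_stepped_surface:
  assumes "x \<in> integer_lattice" "distinct [a, b, i]" "two_face x a b \<subseteq> cube_thickening F"
  shows "omit_coord i ` two_face x a b \<subseteq> stepped_surface \<nu> h i"
proof -
  obtain c where "distinct [a, b, i, c]" by (rule obtain_fourth_distinct[OF assms(2)])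
  then have dist: "distinct [a, b, c, i]" by auto
  have "\<nu> \<bullet> x - h \<in> closed_segment 0 (\<nu> $ c)"
    using face_height[OF assms(3) dist] by (simp add: closed_segment_0_real normal_nth)
  then show ?thesis using assms(1) dist unfolding stepped_surface_def by blast
qed

lemma selected_edge_in_stepped_surface:
  assumes x: "x \<in> integer_lattice" and "b \<noteq> i" and sub: "two_face x i b \<subseteq> cube_thickening F"
  shows "omit_coord i ` two_face x i b \<subseteq> stepped_surface \<nu> h i"
proof -
  obtain c d where dist: "distinct [i, b, c, d]" using obtain_distinct_4 \<open>b \<noteq> i\<close> by metis
  obtain \<epsilon> where \<epsilon>: "\<epsilon> \<in> {0, 1}" "\<nu> \<bullet> x - h - \<epsilon> * \<nu> $ d \<in> closed_segment 0 (\<nu> $ c) \<or>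
      \<nu> \<bullet> x - h - \<epsilon> * \<nu> $ c \<in> closed_segment 0 (\<nu> $ d)"
    by (rule sum_of_segments_covered[OF face_height[OF sub dist]])
  have "omit_coord i ` two_face x i b \<subseteq> stepped_surface \<nu> h i"
    if dist: "distinct [b, e, f, i]" and height: "\<nu> \<bullet> x - h - \<epsilon> * \<nu> $ e \<in> closed_segment 0 (\<nu> $ f)"
    for e f
  proof -
    have "x - \<epsilon> *\<^sub>R axis e 1 \<in> integer_lattice"
      using \<epsilon>(1) x by (intro integer_lattice_diff integer_lattice_scale integer_lattice_axis) auto
    moreover have "\<nu> \<bullet> (x - \<epsilon> *\<^sub>R axis e 1) - h \<in> closed_segment 0 (\<nu> $ f)"
      using height by (simp add: inner_diff_right inner_axis algebra_simps)
    ultimately have "omit_coord i ` two_face (x - \<epsilon> *\<^sub>R axis e 1) b e \<subseteq> stepped_surface \<nu> h i"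
      using dist unfolding stepped_surface_def by blast
    then show ?thesis using omit_coord_edge_subset[OF \<epsilon>(1)] by blast
  qed
  from this[of d c] this[of c d] show ?thesis using dist \<epsilon>(2) by fastforce
qed

lemma stepped_surface_face_selected:
  assumes x: "x \<in> integer_lattice" and dist: "distinct [a, b, c, i]"
    and height: "\<nu> \<bullet> x - h \<in> closed_segment 0 (\<nu> $ c)"
  obtains r where "two_face (x + r *\<^sub>R axis i 1) a b \<in> selected_faces F"
proof -
  obtain \<theta> where \<theta>: "0 \<le> \<theta>" "\<theta> \<le> 1" "\<nu> \<bullet> x - h = \<theta> * \<nu> $ c"
    using height by (auto simp: in_segment)
  have "\<nu> \<bullet> (x - \<theta> *\<^sub>R axis c 1) = h"
    using \<theta> by (simp add: inner_diff_right inner_axis)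
  then obtain l where l: "x - \<theta> *\<^sub>R axis c 1 + l *\<^sub>R axis i 1 \<in> F" unfolding cylinder ..
  let ?x = "x + of_int \<lceil>l\<rceil> *\<^sub>R axis i 1"
  have "two_face ?x a b \<subseteq> cube_thickening F"
  proof
    fix y assume "y \<in> two_face ?x a b"
    then obtain \<alpha> \<beta> where ab: "\<alpha> \<in> {0..1}" "\<beta> \<in> {0..1}"
      and y: "y = ?x + \<alpha> *\<^sub>R axis a 1 + \<beta> *\<^sub>R axis b 1"
      by (rule two_faceE)
    let ?u = "\<theta> *\<^sub>R axis c 1 + (of_int \<lceil>l\<rceil> - l) *\<^sub>R axis i 1 + \<alpha> *\<^sub>R axis a 1 + \<beta> *\<^sub>R axis b (1::real)"
    have "0 \<le> of_int \<lceil>l\<rceil> - l" "of_int \<lceil>l\<rceil> - l \<le> 1" by linarith+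
    then have "?u \<in> unit_cube"
      unfolding unit_cube_def mem_Collect_eq all_4_distinct[OF dist]
      using dist ab \<theta> by (auto simp: axis_def)
    moreover have "y = (x - \<theta> *\<^sub>R axis c 1 + l *\<^sub>R axis i 1) + ?u"
      by (simp add: y algebra_simps)
    ultimately show "y \<in> cube_thickening F" using l unfolding cube_thickening_def by blast
  qed
  moreover have "?x \<in> integer_lattice"
    using x by (intro integer_lattice_add integer_lattice_scale integer_lattice_axis) auto
  ultimately have "two_face ?x a b \<in> selected_faces F"
    using dist unfolding selected_faces_eq by auto
  then show ?thesis by (rule that)
qed

theorem shadow_eq_stepped_surface: "shadow i F = stepped_surface \<nu> h i"
proof
  show "shadow i F \<subseteq> stepped_surface \<nu> h i"
  proof
    fix z assume "z \<in> shadow i F"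
    then obtain x a b where x: "x \<in> integer_lattice" "two_face x a b \<subseteq> cube_thickening F"
      and "a \<noteq> b" and z: "z \<in> omit_coord i ` two_face x a b"
      by (auto simp: shadow_def selected_faces_eq)
    then consider (face) "distinct [a, b, i]" | (edge) "a = i" "b \<noteq> i"
      | (edge_swapped) "b = i" "a \<noteq> i"
      by fastforce
    then have "omit_coord i ` two_face x a b \<subseteq> stepped_surface \<nu> h i"
    proof cases
      case face
      then show ?thesis using x by (intro selected_face_in_stepped_surface)
    next
      case edge
      then show ?thesis using x by (simp add: selected_edge_in_stepped_surface)
    next
      case edge_swapped
      then show ?thesis
        using x by (simp add: two_face_commute[of x a] selected_edge_in_stepped_surface)
    qed
    then show "z \<in> stepped_surface \<nu> h i" using z by blast
  qed
next
  show "stepped_surface \<nu> h i \<subseteq> shadow i F"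
  proof
    fix z assume "z \<in> stepped_surface \<nu> h i"
    then obtain x a b c where x: "x \<in> integer_lattice" "distinct [a, b, c, i]"
      "\<nu> \<bullet> x - h \<in> closed_segment 0 (\<nu> $ c)" and z: "z \<in> omit_coord i ` two_face x a b"
      unfolding stepped_surface_def by blast
    obtain r where "two_face (x + r *\<^sub>R axis i 1) a b \<in> selected_faces F"
      by (rule stepped_surface_face_selected[OF x])
    moreover have "z \<in> omit_coord i ` two_face (x + r *\<^sub>R axis i 1) a b"
      unfolding omit_coord_two_face_shift by (rule z)
    ultimately show "z \<in> shadow i F" unfolding shadow_def by blast
  qed
qed

end

lemma subspace_plus_line_eq_hyperplane:
  fixes S :: "'a::euclidean_space set"
  assumes "subspace S" "dim S + 2 = DIM('a)" "u \<notin> S"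
  obtains \<nu> where "\<And>v. \<nu> \<bullet> v = 0 \<longleftrightarrow> (\<exists>r. v + r *\<^sub>R u \<in> S)"
proof -
  let ?H = "span (insert u S)"
  have spanS: "span S = S" using assms(1) by (simp add: span_eq_iff)
  have dimH: "dim ?H + 1 = DIM('a)"
    using assms(2,3) by (simp add: dim_insert spanS)
  then obtain \<nu> where \<nu>: "\<nu> \<noteq> 0" "?H \<subseteq> {x. \<nu> \<bullet> x = 0}"
    using lowdim_subset_hyperplane[of ?H] by (auto simp: span_span)
  then have "?H = {x. \<nu> \<bullet> x = 0}"
    using dimH dim_hyperplane[OF \<nu>(1)]
    by (intro subspace_dim_equal) (auto simp: subspace_hyperplane)
  then have "\<nu> \<bullet> v = 0 \<longleftrightarrow> (\<exists>r. v - r *\<^sub>R u \<in> S)" for v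
    unfolding span_insert spanS by blast
  also have "(\<exists>r. v - r *\<^sub>R u \<in> S) \<longleftrightarrow> (\<exists>r. v + r *\<^sub>R u \<in> S)" for v
    by (metis add_uminus_conv_diff minus_minus scaleR_minus_left)
  finally show ?thesis by (rule that)
qed

lemma subperiodI:
  assumes E: "two_plane E" and axis: "axis i 1 \<notin> E" and p: "p \<in> E"
    and int: "omit_coord i p \<in> integer_lattice"
    and gcd: "Gcd (range (\<lambda>k. \<lfloor>omit_coord i p $ k\<rfloor>)) = 1"
  shows "subperiod E i p"
proof -
  let ?q = "omit_coord i p"
  have "subspace E" "dim E + 2 = DIM(real^4)" using E by (auto simp: two_plane_def)
  then obtain \<nu> where \<nu>: "\<And>v. \<nu> \<bullet> v = 0 \<longleftrightarrow> (\<exists>r. v + r *\<^sub>R axis i 1 \<in> E)"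
    using axis by (rule subspace_plus_line_eq_hyperplane) blast
  have "0 \<in> E" using \<open>subspace E\<close> by (rule subspace_0)
  then have "axis i 1 + (- 1) *\<^sub>R axis i 1 \<in> E" by simp
  then have \<nu>_axis: "\<nu> \<bullet> axis i 1 = 0" unfolding \<nu> by (rule exI)
  have "\<nu> \<bullet> p = 0" unfolding \<nu> using p by (intro exI[of _ 0]) simp
  then have \<nu>_q: "\<nu> \<bullet> ?q = 0"
    by (simp only: omit_coord_eq inner_diff_right inner_scaleR_right \<nu>_axis)
  have "(+) ?q ` shadow i ((+) s ` E) = shadow i ((+) s ` E)" for s
  proof -
    have "\<nu> \<bullet> v = \<nu> \<bullet> s \<longleftrightarrow> (\<exists>r. v + r *\<^sub>R axis i 1 \<in> (+) s ` E)" for v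
    proof -
      have "y \<in> (+) s ` E \<longleftrightarrow> y - s \<in> E" for y
        by (auto intro: rev_image_eqI[of "y - s"])
      then show ?thesis
        using \<nu>[of "v - s"] by (simp add: inner_diff_right algebra_simps)
    qed
    then interpret hyperplane_cylinder "(+) s ` E" i \<nu> "\<nu> \<bullet> s"
      using \<nu>_axis by unfold_locales (simp_all add: inner_axis)
    have "omit_coord i ?q = ?q" by (simp add: omit_coord_def vec_eq_iff)
    then show ?thesis
      using stepped_surface_translate[OF int \<nu>_q, of i] by (simp add: shadow_eq_stepped_surface)
  qed
  then show ?thesis using p int gcd by (simp add: subperiod_def prime_period_def)
qed

section \<open>Linear algebra\<close>

definition cross2 :: "real^2 \<Rightarrow> real^2 \<Rightarrow> real" where
  "cross2 u v = u $ 1 * v $ 2 - u $ 2 * v $ 1"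

lemma cross2_simps [simp]:
  "cross2 (u + u') v = cross2 u v + cross2 u' v" "cross2 u (v + v') = cross2 u v + cross2 u v'"
  "cross2 (u - u') v = cross2 u v - cross2 u' v" "cross2 u (v - v') = cross2 u v - cross2 u v'"
  "cross2 (r *\<^sub>R u) v = r * cross2 u v" "cross2 u (r *\<^sub>R v) = r * cross2 u v"
  "cross2 u u = 0" "cross2 0 v = 0" "cross2 u 0 = 0"
  by (auto simp: cross2_def algebra_simps)

lemma cross2_commute: "cross2 v u = - cross2 u v"
  by (simp add: cross2_def)

lemma cramer2:
  assumes "cross2 u v \<noteq> 0"
  shows "x = (cross2 x v / cross2 u v) *\<^sub>R u + (cross2 u x / cross2 u v) *\<^sub>R v"
proof -
  have "cross2 u v * x $ j = cross2 x v * u $ j + cross2 u x * v $ j" if "j = 1 \<or> j = 2" for j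
    using that by (auto simp: cross2_def algebra_simps)
  then have "x $ j = cross2 x v / cross2 u v * u $ j + cross2 u x / cross2 u v * v $ j"
    if "j = 1 \<or> j = 2" for j
    using that assms by (simp add: field_simps)
  then show ?thesis by (simp add: vec_eq_iff forall_2)
qed

lemma cross2_combination_eq_0:
  assumes "a *\<^sub>R u + b *\<^sub>R v = 0" "cross2 u v \<noteq> 0"
  shows "a = 0" "b = 0"
  using arg_cong[OF assms(1), of "\<lambda>w. cross2 w v"] arg_cong[OF assms(1), of "cross2 u"] assms(2)
  by simp_all

lemma collinear_iff_cross2: "collinear {0, u, v} \<longleftrightarrow> cross2 u v = 0"
proof -
  have "(cross2 u v)\<^sup>2 + \<bar>u \<bullet> v\<bar>\<^sup>2 = (norm u * norm v)\<^sup>2"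
    by (simp add: power_mult_distrib power2_norm_eq_inner)
      (simp add: cross2_def inner_vec_def sum_2 power2_eq_square algebra_simps)
  then have "cross2 u v = 0 \<longleftrightarrow> \<bar>u \<bullet> v\<bar>\<^sup>2 = (norm u * norm v)\<^sup>2"
    by (metis add_0 add_cancel_left_left power_zero_numeral zero_eq_power2)
  also have "\<dots> \<longleftrightarrow> \<bar>u \<bullet> v\<bar> = norm u * norm v"
    by (rule power2_eq_iff_nonneg) auto
  finally show ?thesis by (simp only: norm_cauchy_schwarz_equal)
qed

lemma cross2_eq_0D:
  assumes "cross2 u v = 0" "u \<noteq> 0"
  obtains c where "v = c *\<^sub>R u"
  using assms by (metis collinear_iff_cross2 collinear_lemma scaleR_zero_left)

lemma independent_pairI:
  fixes u v :: "'a::real_vector"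
  assumes "v \<noteq> 0" "\<And>c. u \<noteq> c *\<^sub>R v"
  shows "independent {u, v}" "u \<noteq> v"
  using assms assms(2)[of 1] by (auto simp: independent_insert span_singleton)

lemma axis_expansion: "(\<Sum>l\<in>UNIV. b $ l *\<^sub>R axis l 1) = (b :: real^'n)"
  using basis_expansion[of b] by (simp add: scalar_mult_eq_scaleR)

lemma subspace_eq_UNIV_if_coarsely_dense:
  fixes V :: "'a::euclidean_space set"
  assumes "subspace V" and near: "\<And>z. \<exists>v\<in>V. norm (z - v) \<le> C"
  shows "V = UNIV"
proof (rule ccontr)
  assume "V \<noteq> UNIV"
  then have "span V \<subset> span UNIV" using assms(1) by (auto simp: span_eq_iff[THEN iffD2])
  then obtain a where a: "a \<noteq> 0" "\<And>v. v \<in> V \<Longrightarrow> a \<bullet> v = 0"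
    using orthogonal_to_subspace_exists_gen span_base unfolding orthogonal_def by metis
  define s where "s = (C + 1) / norm a"
  obtain v where v: "v \<in> V" "norm (s *\<^sub>R a - v) \<le> C" using near by blast
  have "s * norm a * norm a = a \<bullet> (s *\<^sub>R a - v)"
    by (simp add: inner_diff_right a(2)[OF v(1)] power2_norm_eq_inner[symmetric] power2_eq_square)
  also have "\<dots> \<le> norm a * norm (s *\<^sub>R a - v)" by (rule norm_cauchy_schwarz)
  also have "\<dots> \<le> C * norm a"
    using mult_left_mono[OF v(2), of "norm a"] by (simp add: mult.commute)
  finally show False using a(1) by (simp add: s_def)
qed

lemma inj_on_span_if_dim_image:
  fixes f :: "'a::euclidean_space \<Rightarrow> 'b::euclidean_space"
  assumes "linear f" "dim (f ` S) = dim S"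
  shows "inj_on f (span S)"
proof -
  obtain B where B: "B \<subseteq> S" "independent B" "S \<subseteq> span B" "card B = dim S"
    using basis_exists by blast
  then have "finite B" using independent_imp_finite by blast
  have span: "f ` S \<subseteq> span (f ` B)"
    using B(3) linear_span_image[OF assms(1), of B] by blast
  have "dim (f ` S) \<le> card (f ` B)"
    using span \<open>finite B\<close> by (intro dim_le_card) auto
  then have card: "card (f ` B) = card B"
    using B(4) assms(2) card_image_le[OF \<open>finite B\<close>, of f] by simp
  then have "inj_on f B" using \<open>finite B\<close> by (intro eq_card_imp_inj_on)
  moreover have "independent (f ` B)"
    using B card assms(2) span \<open>finite B\<close> by (intro card_le_dim_spanning[of _ "f ` S"]) auto
  ultimately have "inj_on f (span B)"
    by (simp add: linear_inj_on_span_iff_independent_image[OF assms(1)])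
  moreover have "span S \<subseteq> span B" using B(3) by (simp add: span_minimal)
  ultimately show ?thesis by (rule inj_on_subset)
qed

lemma finite_singular_scales:
  fixes \<mu> :: "'n::finite \<Rightarrow> real"
  shows "finite {s. \<exists>i. 1 + s * \<mu> i = 0}"
proof (rule finite_subset)
  show "{s. \<exists>i. 1 + s * \<mu> i = 0} \<subseteq> range (\<lambda>i. - 1 / \<mu> i)"
  proof clarify
    fix s i assume "1 + s * \<mu> i = 0"
    then have "s = - 1 / \<mu> i" by (cases "\<mu> i = 0") (auto simp: field_simps)
    then show "s \<in> range (\<lambda>i. - 1 / \<mu> i)" by blast
  qed
qed simp

section \<open>Rational linear systems\<close>

lemma rational_functional:
  fixes x :: real
  assumes "x \<notin> \<rat>"
  obtains f :: "real \<Rightarrow> real" where "\<And>a b. f (a + b) = f a + f b"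
    "\<And>q y. q \<in> \<rat> \<Longrightarrow> f (q * y) = q * f y" "f 1 = 0" "f x = 1"
proof -
  let ?scale = "\<lambda>(q::rat) (y::real). of_rat q * y"
  interpret Q: vector_space ?scale
    by unfold_locales (auto simp: algebra_simps of_rat_add of_rat_mult)
  interpret QQ: vector_space_pair ?scale ?scale ..
  have "x \<noteq> 1" using assms by auto
  have "x \<notin> Q.span {1}"
    using assms by (auto simp: Q.span_singleton)
  then have "Q.independent {x, 1}" by (rule Q.independent_insertI) simp
  then obtain f where f: "Vector_Spaces.linear ?scale ?scale f"
    "\<forall>y\<in>{x, 1}. f y = (if y = 1 then 0 else 1)"
    using QQ.linear_independent_extend[of "{x, 1}" "\<lambda>y. if y = 1 then 0 else 1"] by auto
  interpret f: Vector_Spaces.linear ?scale ?scale f by (rule f(1))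
  show ?thesis
  proof (rule that[of f])
    show "f (a + b) = f a + f b" for a b by (rule f.add)
    show "f (q * y) = q * f y" if "q \<in> \<rat>" for q y
      using that f.scale by (auto elim!: Rats_cases)
  qed (use f(2) \<open>x \<noteq> 1\<close> in auto)
qed

text \<open>A rational-linear functional that kills \<open>1\<close> turns a solution into one of the homogeneous
  system.\<close>

lemma unique_solution_rational:
  fixes A :: "'r \<Rightarrow> 'n::finite \<Rightarrow> real"
  assumes A: "\<And>r l. r \<in> R \<Longrightarrow> A r l \<in> \<rat>" and b: "\<And>r. r \<in> R \<Longrightarrow> b r \<in> \<rat>"
    and solution: "\<And>r. r \<in> R \<Longrightarrow> (\<Sum>l\<in>UNIV. A r l * x l) = b r"
    and unique: "\<And>y l. (\<And>r. r \<in> R \<Longrightarrow> (\<Sum>l\<in>UNIV. A r l * y l) = 0) \<Longrightarrow> y l = 0"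
  shows "x l \<in> \<rat>"
proof (rule ccontr)
  assume "x l \<notin> \<rat>"
  then obtain f :: "real \<Rightarrow> real" where add: "\<And>a b. f (a + b) = f a + f b"
    and scale: "\<And>q y. q \<in> \<rat> \<Longrightarrow> f (q * y) = q * f y" and "f 1 = 0" "f (x l) = 1"
    by (rule rational_functional) blast
  interpret additive f by unfold_locales (rule add)
  have "(\<Sum>l\<in>UNIV. A r l * f (x l)) = 0" if r: "r \<in> R" for r
  proof -
    have "(\<Sum>l\<in>UNIV. A r l * f (x l)) = f (\<Sum>l\<in>UNIV. A r l * x l)"
      by (simp add: sum scale A r)
    also have "\<dots> = f (b r * 1)" by (simp add: solution r)
    also have "\<dots> = 0" using \<open>f 1 = 0\<close> by (simp only: scale b r mult_zero_right)
    finally show ?thesis .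
  qed
  then have "f (x l) = 0" by (rule unique)
  then show False using \<open>f (x l) = 1\<close> by simp
qed

lemma rational_coordinate_of_orthogonal:
  fixes a x y z :: "real^3"
  assumes orth: "a \<bullet> x = 0" "a \<bullet> y = 0" "a \<bullet> z = 0" and "a $ 1 \<noteq> 0"
    and indep: "\<not> collinear {0, x, y}"
    and rat: "\<And>l. x $ l \<in> \<rat>" "\<And>l. y $ l \<in> \<rat>" "z $ 2 \<in> \<rat>" "z $ 3 \<in> \<rat>"
  shows "z $ 1 \<in> \<rat>"
proof -
  let ?n = "cross3 x y"
  have "cross3 a ?n = 0" by (simp add: Lagrange orth)
  moreover have "?n \<noteq> 0" using indep by (simp add: cross_eq_0)
  moreover have "a \<noteq> 0" using \<open>a $ 1 \<noteq> 0\<close> by auto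
  ultimately obtain c where normal: "?n = c *\<^sub>R a" by (auto simp: cross_eq_0 collinear_lemma)
  then have "?n $ 1 \<noteq> 0" using \<open>?n \<noteq> 0\<close> \<open>a $ 1 \<noteq> 0\<close> by auto
  have "?n $ 1 * z $ 1 + ?n $ 2 * z $ 2 + ?n $ 3 * z $ 3 = ?n \<bullet> z"
    by (simp add: inner_vec_def sum_3)
  also have "\<dots> = 0" by (simp add: normal orth)
  finally have "z $ 1 = - (?n $ 2 * z $ 2 + ?n $ 3 * z $ 3) / ?n $ 1"
    using \<open>?n $ 1 \<noteq> 0\<close> by (simp add: eq_divide_eq algebra_simps)
  also have "?n $ l \<in> \<rat>" for l
    using rat exhaust_3[of l] by (auto simp: cross_components)
  then have "- (?n $ 2 * z $ 2 + ?n $ 3 * z $ 3) / ?n $ 1 \<in> \<rat>"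
    using rat by simp
  finally show ?thesis .
qed

lemma common_denominator:
  fixes v :: "real^'n"
  assumes "\<And>l. v $ l \<in> \<rat>"
  obtains n :: nat where "n \<noteq> 0" "\<And>l. real n * v $ l \<in> \<int>"
proof -
  have "\<exists>n::nat. n \<noteq> 0 \<and> real n * v $ l \<in> \<int>" for l
  proof -
    obtain a :: int and b :: nat where "b \<noteq> 0" "v $ l = of_int a / of_nat b"
      using assms[of l] by (auto simp: Rats_eq_int_div_nat)
    then show ?thesis by (intro exI[of _ b]) auto
  qed
  then obtain n :: "'n \<Rightarrow> nat" where n: "\<And>l. n l \<noteq> 0" "\<And>l. real (n l) * v $ l \<in> \<int>" by metis
  have "real (\<Prod>l\<in>UNIV. n l) * v $ m \<in> \<int>" for m
  proof -
    have "real (\<Prod>l\<in>UNIV. n l) * v $ m = real (\<Prod>l\<in>UNIV - {m}. n l) * (real (n m) * v $ m)"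
      by (simp add: prod.remove[of UNIV m])
    also have "\<dots> \<in> \<int>" by (rule Ints_mult[OF Ints_of_nat n(2)])
    finally show ?thesis .
  qed
  then show ?thesis using n(1) by (intro that[of "\<Prod>l\<in>UNIV. n l"]) auto
qed

section \<open>Slopes with a fine projection\<close>

lemma norm_unit_cube:
  assumes "u \<in> unit_cube"
  shows "norm u \<le> 4"
proof -
  have "(\<Sum>i\<in>UNIV. \<bar>u $ i\<bar>) \<le> (\<Sum>i\<in>(UNIV :: 4 set). 1)"
    using assms by (intro sum_mono) (auto simp: unit_cube_def)
  then show ?thesis using norm_le_l1_cart[of u] by simp
qed

lemma projection_inj_on_slope:
  assumes E: "two_plane E" and lin: "linear \<pi>" and tiling: "projects_to_tiling ((+) s ` E) \<pi>"
  shows "inj_on \<pi> E"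
proof -
  have sub: "subspace E" and dim: "dim E = 2" using E by (auto simp: two_plane_def)
  obtain B where B: "B > 0" "\<And>x. norm (\<pi> x) \<le> B * norm x" using linear_bounded_pos[OF lin] by blast
  have "\<exists>v\<in>\<pi> ` E. norm (z - v) \<le> B * 4" for z
  proof -
    have "\<pi> s + z \<in> \<Union>(projected_tiles ((+) s ` E) \<pi>)"
      using tiling by (simp add: projects_to_tiling_def plane_tiling_def)
    then obtain x i j y where "y \<in> two_face x i j" "\<pi> s + z = \<pi> y"
      "two_face x i j \<subseteq> cube_thickening ((+) s ` E)"
      unfolding projected_tiles_def selected_faces_eq by blast
    then obtain e u where y: "y = s + e + u" "e \<in> E" "u \<in> unit_cube"
      unfolding cube_thickening_def by blast
    then have "z - \<pi> e = \<pi> u"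
      using \<open>\<pi> s + z = \<pi> y\<close> by (simp add: linear_add[OF lin] algebra_simps)
    moreover have "norm (\<pi> u) \<le> B * 4"
      using B(2)[of u] mult_left_mono[OF norm_unit_cube[OF y(3)], of B] B(1) by linarith
    ultimately show ?thesis using y(2) by (metis imageI)
  qed
  then have "\<pi> ` E = UNIV"
    by (rule subspace_eq_UNIV_if_coarsely_dense[OF linear_subspace_image[OF lin sub]])
  then have "inj_on \<pi> (span E)"
    by (intro inj_on_span_if_dim_image[OF lin]) (simp add: dim)
  then show ?thesis using sub by (simp add: span_eq_iff[THEN iffD2])
qed

locale fine_slope =
  fixes E :: "(real^4) set" and p :: "4 \<Rightarrow> real^4" and \<pi> :: "real^4 \<Rightarrow> real^2"
  assumes plane: "two_plane E"
    and irrational: "totally_irrational E"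
    and characterized: "characterized_by_subperiods E p"
    and fine: "fine_projection E p \<pi>"
begin

abbreviation dir :: "4 \<Rightarrow> real^2" where "dir i \<equiv> \<pi> (p i)"

definition axis_ratio :: "4 \<Rightarrow> real" (\<open>\<kappa>\<close>) where
  "\<kappa> i = (\<pi> (axis i 1) \<bullet> dir i) / (dir i \<bullet> dir i)"

definition kernel_vec :: "4 \<Rightarrow> real^4" where
  "kernel_vec i = p i - (1 / \<kappa> i) *\<^sub>R axis i 1"

lemma subspace_E: "subspace E" using plane by (simp add: two_plane_def)

lemma linear_\<pi>: "linear \<pi>"
  using fine by (simp add: fine_projection_def valid_projection_def)

lemmas \<pi>_simps =
  linear_add[OF linear_\<pi>] linear_diff[OF linear_\<pi>] linear_scale[OF linear_\<pi>] linear_0[OF linear_\<pi>]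

lemma \<pi>_axis_cross: "i \<noteq> j \<Longrightarrow> cross2 (\<pi> (axis i 1)) (\<pi> (axis j 1)) \<noteq> 0"
  using fine by (simp add: fine_projection_def valid_projection_def collinear_iff_cross2)

lemma \<pi>_axis_nonzero: "\<pi> (axis i 1) \<noteq> 0"
proof -
  obtain j where "j \<noteq> i" by (metis zero_neq_one)
  then show ?thesis using \<pi>_axis_cross[of j i] by auto
qed

lemma obtain_tiling: obtains s where "projects_to_tiling ((+) s ` E) \<pi>"
  using fine by (auto simp: fine_projection_def valid_projection_def cut_and_project_tilings_def)

lemma \<pi>_inj_E: "v \<in> E \<Longrightarrow> w \<in> E \<Longrightarrow> \<pi> v = \<pi> w \<Longrightarrow> v = w"
  by (rule obtain_tiling) (meson projection_inj_on_slope[OF plane linear_\<pi>] inj_onD)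

lemma p_subperiod: "subperiod E i (p i)"
  using characterized by (simp add: characterized_by_subperiods_def)

lemma p_mem: "p i \<in> E"
  using p_subperiod by (simp add: subperiod_def)

lemma omit_p_integral: "omit_coord i (p i) \<in> integer_lattice"
  and omit_p_Gcd: "Gcd (range (\<lambda>k. \<lfloor>omit_coord i (p i) $ k\<rfloor>)) = 1"
proof -
  obtain s where "projects_to_tiling ((+) s ` E) \<pi>" by (rule obtain_tiling)
  then have "prime_period (shadow i ((+) s ` E)) (omit_coord i (p i))"
    using p_subperiod[of i] by (simp add: subperiod_def projects_to_tiling_def)
  then show "omit_coord i (p i) \<in> integer_lattice"
    "Gcd (range (\<lambda>k. \<lfloor>omit_coord i (p i) $ k\<rfloor>)) = 1"
    by (simp_all add: prime_period_def)
qed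

lemma p_nth_int: "j \<noteq> i \<Longrightarrow> p i $ j \<in> \<int>"
  using omit_p_integral[of i] by (metis integer_lattice_def mem_Collect_eq omit_coord_nth)

lemma ex_p_nth_nonzero: "\<exists>j. j \<noteq> i \<and> p i $ j \<noteq> 0"
proof (rule ccontr)
  assume "\<nexists>j. j \<noteq> i \<and> p i $ j \<noteq> 0"
  then have "omit_coord i (p i) = 0" by (auto simp: omit_coord_def vec_eq_iff)
  then show False using omit_p_Gcd[of i] by simp
qed

lemma dir_nonzero: "dir i \<noteq> 0"
proof
  assume "dir i = 0"
  then have "p i = 0" using \<pi>_inj_E[OF p_mem subspace_0[OF subspace_E]] by (simp add: \<pi>_simps)
  then show False using ex_p_nth_nonzero[of i] by simp
qed

lemma \<pi>_axis: "\<pi> (axis i 1) = \<kappa> i *\<^sub>R dir i"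
proof -
  have "cross2 (dir i) (\<pi> (axis i 1)) = 0"
    using fine by (simp add: fine_projection_def collinear_iff_cross2)
  then obtain c where "\<pi> (axis i 1) = c *\<^sub>R dir i" using dir_nonzero by (rule cross2_eq_0D)
  then show ?thesis using dir_nonzero by (simp add: axis_ratio_def)
qed

lemma axis_ratio_nonzero: "\<kappa> i \<noteq> 0"
  using \<pi>_axis[of i] \<pi>_axis_nonzero[of i] by auto

lemma dir_cross: "i \<noteq> j \<Longrightarrow> cross2 (dir i) (dir j) \<noteq> 0"
  using \<pi>_axis_cross[of i j] by (auto simp: \<pi>_axis)

lemma \<pi>_kernel_vec: "\<pi> (kernel_vec i) = 0"
  by (simp add: kernel_vec_def \<pi>_simps \<pi>_axis axis_ratio_nonzero)

lemma kernel_vec_nth: "j \<noteq> i \<Longrightarrow> kernel_vec i $ j = p i $ j"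
  by (simp add: kernel_vec_def axis_def)

lemma kernel_vec_nth_int: "j \<noteq> i \<Longrightarrow> kernel_vec i $ j \<in> \<int>"
  by (simp add: kernel_vec_nth p_nth_int)

lemma kernel_vec_nonzero: "kernel_vec i \<noteq> 0"
  using ex_p_nth_nonzero[of i] kernel_vec_nth by (metis zero_index)

lemma kernel_eq_0I:
  assumes "\<pi> b = 0" "i \<noteq> j" "\<And>l. l \<noteq> i \<Longrightarrow> l \<noteq> j \<Longrightarrow> b $ l = 0"
  shows "b = 0"
proof -
  have b: "b = b $ i *\<^sub>R axis i 1 + b $ j *\<^sub>R axis j 1"
    using assms(2,3) by (auto simp: vec_eq_iff axis_def)
  then have "b $ i *\<^sub>R \<pi> (axis i 1) + b $ j *\<^sub>R \<pi> (axis j 1) = 0"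
    using assms(1) by (metis \<pi>_simps(1,3))
  from cross2_combination_eq_0[OF this \<pi>_axis_cross[OF assms(2)]] show ?thesis
    using b by simp
qed

lemma kernel_eqI:
  assumes "\<pi> v = 0" "\<pi> w = 0" "\<And>j. j \<noteq> i \<Longrightarrow> v $ j = w $ j"
  shows "v = w"
proof -
  obtain j where "i \<noteq> j" by (metis zero_neq_one)
  then have "v - w = 0"
    using assms by (intro kernel_eq_0I[of _ i j]) (simp_all add: \<pi>_simps)
  then show ?thesis by simp
qed

lemma dim_kernel_le: "dim {v. \<pi> v = 0} \<le> 2"
proof -
  define t :: "real^4 \<Rightarrow> real^2" where "t v = (\<chi> n. if n = 1 then v $ 1 else v $ 2)" for v
  have lin: "linear t" by (rule linearI) (auto simp: t_def vec_eq_iff)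
  have sub: "subspace {v. \<pi> v = 0}" by (rule linear_subspace_kernel[OF linear_\<pi>])
  have "v = 0" if "\<pi> v = 0" "t v = 0" for v
  proof (rule kernel_eq_0I[OF that(1), of 3 4])
    have "v $ 1 = 0" "v $ 2 = 0" using that(2) by (auto simp: t_def vec_eq_iff forall_2)
    then show "v $ l = 0" if "l \<noteq> 3" "l \<noteq> 4" for l
      using that exhaust_4[of l] by auto
  qed simp
  then have "inj_on t (span {v. \<pi> v = 0})"
    unfolding span_eq_iff[THEN iffD2, OF sub] linear_inj_on_iff_eq_0[OF lin sub] by blast
  then show ?thesis
    using dim_image_eq[OF lin] dim_subset_UNIV[of "t ` {v. \<pi> v = 0}"] by simp
qed

lemma kernel_subset_span:
  assumes "\<And>c. kernel_vec i \<noteq> c *\<^sub>R kernel_vec j"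
  shows "{v. \<pi> v = 0} \<subseteq> span {kernel_vec i, kernel_vec j}"
  using independent_pairI[OF kernel_vec_nonzero assms] dim_kernel_le
  by (intro card_ge_dim_independent) (auto simp: \<pi>_kernel_vec)

definition slope_section :: "real^2 \<Rightarrow> real^4" (\<open>\<sigma>\<close>) where
  "\<sigma> v = (cross2 v (dir 1) / cross2 (dir 0) (dir 1)) *\<^sub>R p 0 +
    (cross2 (dir 0) v / cross2 (dir 0) (dir 1)) *\<^sub>R p 1"

lemma linear_slope_section: "linear \<sigma>"
  by (rule linearI) (simp_all add: slope_section_def algebra_simps add_divide_distrib)

lemma slope_section_mem: "\<sigma> v \<in> E"
  unfolding slope_section_def by (intro subspace_add subspace_scale subspace_E p_mem)

lemma \<pi>_slope_section: "\<pi> (\<sigma> v) = v"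
  unfolding slope_section_def using cramer2[OF dir_cross[of 0 1], of v] by (simp add: \<pi>_simps)

lemma slope_section_\<pi>: "v \<in> E \<Longrightarrow> \<sigma> (\<pi> v) = v"
  by (rule \<pi>_inj_E[OF slope_section_mem _ \<pi>_slope_section])

section \<open>Deformations of the slope\<close>

definition deform :: "(real^2 \<Rightarrow> real^4) \<Rightarrow> real^4 \<Rightarrow> real^4" where
  "deform g v = v + g (\<pi> v)"

lemma deform_image_inj:
  assumes "deform g ` E = deform g' ` E" "\<And>w. \<pi> (g w) = 0" "\<And>w. \<pi> (g' w) = 0"
  shows "g v = g' v"
proof -
  obtain w where w: "w \<in> E" "deform g (\<sigma> v) = deform g' w"
    using assms(1) slope_section_mem by (metis imageE imageI)
  have "v = \<pi> w"
    using arg_cong[OF w(2), of \<pi>] assms(2,3) by (simp add: deform_def \<pi>_simps \<pi>_slope_section)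
  then show ?thesis using w by (simp add: deform_def \<pi>_slope_section slope_section_\<pi>)
qed

context
  fixes g :: "real^2 \<Rightarrow> real^4" and \<mu> :: "4 \<Rightarrow> real"
  assumes linear_g: "linear g" and g_dir: "\<And>i. g (dir i) = \<mu> i *\<^sub>R kernel_vec i"
begin

lemma \<pi>_deformation: "\<pi> (g w) = 0"
proof -
  obtain a b where "w = a *\<^sub>R dir 0 + b *\<^sub>R dir 1"
    using cramer2[OF dir_cross[of 0 1], of w] by auto
  then show ?thesis
    by (simp add: linear_add[OF linear_g] linear_scale[OF linear_g] g_dir \<pi>_simps \<pi>_kernel_vec)
qed

lemma linear_deform: "linear (deform g)"
  by (rule linearI)
    (simp_all add: deform_def \<pi>_simps linear_add[OF linear_g] linear_scale[OF linear_g]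
      algebra_simps)

lemma \<pi>_deform: "\<pi> (deform g v) = \<pi> v"
  by (simp add: deform_def \<pi>_simps \<pi>_deformation)

lemma two_plane_deform: "two_plane (deform g ` E)"
proof -
  have "inj_on (deform g) (span E)"
    unfolding span_eq_iff[THEN iffD2, OF subspace_E]
    by (rule inj_onI) (metis \<pi>_deform \<pi>_inj_E)
  then show ?thesis
    using plane linear_deform by (simp add: two_plane_def dim_image_eq linear_subspace_image)
qed

lemma deform_p: "deform g (p i) = (1 + \<mu> i) *\<^sub>R p i - (\<mu> i / \<kappa> i) *\<^sub>R axis i 1"
  by (simp add: deform_def g_dir kernel_vec_def algebra_simps)

lemma axis_notin_deform:
  assumes "1 + \<mu> i \<noteq> 0"
  shows "axis i 1 \<notin> deform g ` E"
proof
  assume "axis i 1 \<in> deform g ` E"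
  then obtain w where w: "w \<in> E" "axis i 1 = deform g w" by blast
  have "\<pi> w = \<pi> (\<kappa> i *\<^sub>R p i)"
    using arg_cong[OF w(2), of \<pi>] by (simp add: \<pi>_deform \<pi>_axis \<pi>_simps)
  then have "w = \<kappa> i *\<^sub>R p i"
    by (rule \<pi>_inj_E[OF w(1) subspace_scale[OF subspace_E p_mem]])
  then have axis: "axis i 1 = \<kappa> i *\<^sub>R ((1 + \<mu> i) *\<^sub>R p i - (\<mu> i / \<kappa> i) *\<^sub>R axis i 1)"
    using w(2) by (simp only: linear_scale[OF linear_deform] deform_p)
  obtain j where "j \<noteq> i" "p i $ j \<noteq> 0" using ex_p_nth_nonzero by blast
  then show False
    using arg_cong[OF axis, of "\<lambda>v. v $ j"] assms axis_ratio_nonzero[of i] by (simp add: axis_def)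
qed

lemma subperiod_deform:
  assumes "1 + \<mu> i \<noteq> 0"
  obtains p' where "subperiod (deform g ` E) i p'" "omit_coord i p' = omit_coord i (p i)"
proof
  define p' where "p' = p i - (\<mu> i / (\<kappa> i * (1 + \<mu> i))) *\<^sub>R axis i 1"
  show omit: "omit_coord i p' = omit_coord i (p i)"
    by (simp add: p'_def omit_coord_def vec_eq_iff axis_def)
  have "deform g ((1 / (1 + \<mu> i)) *\<^sub>R p i) = p'"
    using assms axis_ratio_nonzero[of i] unfolding linear_scale[OF linear_deform] deform_p p'_def
    by (simp add: scaleR_diff_right mult.commute)
  then have "p' \<in> deform g ` E"
    using subspace_scale[OF subspace_E p_mem] by (metis imageI)
  then show "subperiod (deform g ` E) i p'"
    by (rule subperiodI[OF two_plane_deform axis_notin_deform[OF assms]])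
      (simp_all add: omit omit_p_integral omit_p_Gcd)
qed

end

theorem no_deformation:
  assumes g: "linear g" and "\<And>i. \<exists>\<mu>. g (dir i) = \<mu> *\<^sub>R kernel_vec i"
  shows "g v = 0"
proof (rule ccontr)
  assume "g v \<noteq> 0"
  obtain \<mu> where \<mu>: "\<And>i. g (dir i) = \<mu> i *\<^sub>R kernel_vec i" using assms(2) by metis
  have scaled: "linear (\<lambda>w. s *\<^sub>R g w)" "\<And>i. s *\<^sub>R g (dir i) = (s * \<mu> i) *\<^sub>R kernel_vec i" for s
    using g by (simp_all add: \<mu> linear_compose_scale_right)
  define S where "S = - {s. \<exists>i. 1 + s * \<mu> i = 0}"
  have "infinite S"
    unfolding S_def using finite_singular_scales[of \<mu>] infinite_UNIV_char_0[where 'a = real]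
    by (simp add: finite_compl)
  have "inj_on (\<lambda>s. deform (\<lambda>w. s *\<^sub>R g w) ` E) S"
  proof (rule inj_onI)
    fix s t assume "deform (\<lambda>w. s *\<^sub>R g w) ` E = deform (\<lambda>w. t *\<^sub>R g w) ` E"
    then have "s *\<^sub>R g v = t *\<^sub>R g v"
      by (rule deform_image_inj) (rule \<pi>_deformation[OF scaled])+
    then show "s = t" using \<open>g v \<noteq> 0\<close> by simp
  qed
  moreover have "(\<lambda>s. deform (\<lambda>w. s *\<^sub>R g w) ` E) ` S \<subseteq> {E'. two_plane E' \<and>
       (\<exists>p'. \<forall>i. subperiod E' i (p' i) \<and> omit_coord i (p' i) = omit_coord i (p i))}"
  proof clarify
    fix s assume "s \<in> S"
    then have nonzero: "1 + s * \<mu> i \<noteq> 0" for i by (simp add: S_def)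
    have "\<forall>i. \<exists>p'. subperiod (deform (\<lambda>w. s *\<^sub>R g w) ` E) i p' \<and>
        omit_coord i p' = omit_coord i (p i)"
      by (rule allI, rule subperiod_deform[OF scaled nonzero]) blast
    then show "two_plane (deform (\<lambda>w. s *\<^sub>R g w) ` E) \<and> (\<exists>p'. \<forall>i.
      subperiod (deform (\<lambda>w. s *\<^sub>R g w) ` E) i (p' i) \<and> omit_coord i (p' i) = omit_coord i (p i))"
      by (intro conjI two_plane_deform[OF scaled] choice)
  qed
  ultimately show False
    using \<open>infinite S\<close> characterized
    unfolding characterized_by_subperiods_def by (meson finite_imageD finite_subset)
qed

section \<open>Lattice vectors and the projection\<close>

lemma ex_kernel_vec_not_collinear:
  assumes "v \<noteq> 0"
  shows "\<exists>j. j \<noteq> i \<and> (\<forall>c. v \<noteq> c *\<^sub>R kernel_vec j)"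
proof (rule ccontr)
  assume "\<not> ?thesis"
  then have par: "\<exists>c. v = c *\<^sub>R kernel_vec j" if "j \<noteq> i" for j using that by blast
  let ?g = "\<lambda>x. cross2 (dir i) x *\<^sub>R v"
  have "linear ?g" by (rule linearI) (simp_all add: algebra_simps)
  moreover have "\<exists>\<mu>. ?g (dir j) = \<mu> *\<^sub>R kernel_vec j" for j
  proof (cases "j = i")
    case True
    then show ?thesis by (intro exI[of _ 0]) simp
  next
    case False
    then obtain c where "v = c *\<^sub>R kernel_vec j" using par by blast
    then show ?thesis by (intro exI[of _ "cross2 (dir i) (dir j) * c"]) simp
  qed
  ultimately have "?g x = 0" for x by (rule no_deformation)
  moreover obtain j where "j \<noteq> i" by (metis zero_neq_one)
  ultimately show False using dir_cross[of i j] assms by auto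
qed

lemma kernel_expansion:
  assumes "\<pi> b = 0"
  shows "(\<Sum>l\<in>UNIV. (b $ l * \<kappa> l) *\<^sub>R kernel_vec l) = - b"
proof -
  have "\<pi> (\<Sum>l\<in>UNIV. (b $ l * \<kappa> l) *\<^sub>R p l) = \<pi> (\<Sum>l\<in>UNIV. b $ l *\<^sub>R axis l 1)"
    by (simp add: linear_sum[OF linear_\<pi>] \<pi>_simps \<pi>_axis)
  also have "\<dots> = \<pi> 0" using assms by (simp add: axis_expansion \<pi>_simps)
  finally have "(\<Sum>l\<in>UNIV. (b $ l * \<kappa> l) *\<^sub>R p l) = 0"
    by (rule \<pi>_inj_E[rotated 2]) (intro subspace_sum subspace_scale subspace_0 subspace_E p_mem)+
  moreover have "(b $ l * \<kappa> l) *\<^sub>R kernel_vec l = (b $ l * \<kappa> l) *\<^sub>R p l - b $ l *\<^sub>R axis l 1" for l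
    by (simp add: kernel_vec_def scaleR_diff_right axis_ratio_nonzero)
  ultimately show ?thesis by (simp add: sum_subtractf axis_expansion)
qed

text \<open>By \<open>kernel_expansion\<close>, the numbers \<open>\<kappa> l\<close> solve the inhomogeneous system with right-hand sides
  \<open>- kernel_vec w $ r\<close>. Uniqueness is the rigidity of the slope.\<close>

lemma kernel_weights_eq_0:
  assumes "\<And>w r. w \<noteq> i \<Longrightarrow> r \<noteq> i \<Longrightarrow> (\<Sum>l\<in>UNIV. kernel_vec w $ l * kernel_vec l $ r * c l) = 0"
  shows "c v = 0"
proof -
  define G where "G b = (\<Sum>l\<in>UNIV. (b $ l * c l) *\<^sub>R kernel_vec l)" for b :: "real^4"
  have lin: "linear G"
    by (rule linearI) (simp_all add: G_def algebra_simps sum.distrib scaleR_sum_right)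
  have G_kernel_vec: "G (kernel_vec w) = 0" if "w \<noteq> i" for w
  proof (rule kernel_eqI[of _ _ i])
    show "\<pi> (G (kernel_vec w)) = 0"
      by (simp add: G_def linear_sum[OF linear_\<pi>] \<pi>_simps \<pi>_kernel_vec)
    show "G (kernel_vec w) $ r = 0 $ r" if "r \<noteq> i" for r
      using assms[OF \<open>w \<noteq> i\<close> that] by (simp add: G_def mult_ac)
  qed (simp add: \<pi>_simps)
  obtain j where j: "j \<noteq> i" by (metis zero_neq_one)
  obtain u where u: "u \<noteq> i" "\<And>c. kernel_vec j \<noteq> c *\<^sub>R kernel_vec u"
    using ex_kernel_vec_not_collinear[OF kernel_vec_nonzero] by blast
  have G_kernel: "G b = 0" if "\<pi> b = 0" for b
  proof (rule linear_eq_0_on_span[OF lin])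
    show "b \<in> span {kernel_vec j, kernel_vec u}" using kernel_subset_span[OF u(2)] that by blast
  qed (use G_kernel_vec j u(1) in auto)
  have G_axis: "G (axis l 1) = c l *\<^sub>R kernel_vec l" for l
  proof -
    have "(axis l 1 $ m * c m) *\<^sub>R kernel_vec m = (if m = l then c l *\<^sub>R kernel_vec l else 0)" for m
      by (auto simp: axis_def)
    then show ?thesis by (simp add: G_def)
  qed
  have "G (p l - (1 / \<kappa> l) *\<^sub>R axis l 1) = 0" for l
    by (rule G_kernel) (use \<pi>_kernel_vec in \<open>simp add: kernel_vec_def\<close>)
  then have G_p: "G (\<sigma> (dir l)) = (c l / \<kappa> l) *\<^sub>R kernel_vec l" for l
    by (simp add: linear_diff[OF lin] linear_scale[OF lin] G_axis slope_section_\<pi> p_mem)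
  have "G (\<sigma> (dir v)) = 0"
    by (rule no_deformation[of "\<lambda>x. G (\<sigma> x)"])
      (use G_p linear_compose[OF linear_slope_section lin] in \<open>auto simp: o_def\<close>)
  then show ?thesis using G_p[of v] kernel_vec_nonzero[of v] axis_ratio_nonzero[of v] by simp
qed

lemma kernel_vec_not_all_rational: "\<exists>u l. u \<noteq> i \<and> kernel_vec u $ l \<notin> \<rat>"
proof (rule ccontr)
  assume "\<not> ?thesis"
  then have rat: "kernel_vec u $ l \<in> \<rat>" if "u \<noteq> i" for u l using that by blast
  have axis_ratio_rat: "\<kappa> v \<in> \<rat>" for v
  proof (rule unique_solution_rational[where R = "{r. fst r \<noteq> i \<and> snd r \<noteq> i}"
      and A = "\<lambda>r l. kernel_vec (fst r) $ l * kernel_vec l $ snd r"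
      and b = "\<lambda>r. - kernel_vec (fst r) $ snd r"])
    fix r :: "4 \<times> 4" and l assume r: "r \<in> {r. fst r \<noteq> i \<and> snd r \<noteq> i}"
    have "kernel_vec l $ snd r \<in> \<rat>"
      using rat[of l] kernel_vec_nth_int[of "snd r" l] r Ints_subset_Rats by (cases "l = i") auto
    then show "kernel_vec (fst r) $ l * kernel_vec l $ snd r \<in> \<rat>" "- kernel_vec (fst r) $ snd r \<in> \<rat>"
      using rat[of "fst r"] r by auto
    show "(\<Sum>l\<in>UNIV. kernel_vec (fst r) $ l * kernel_vec l $ snd r * \<kappa> l) =
        - kernel_vec (fst r) $ snd r"
      using arg_cong[OF kernel_expansion[OF \<pi>_kernel_vec], of "\<lambda>v. v $ snd r" "fst r"]
      by (simp add: mult_ac)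
  next
    fix c l
    assume homogeneous: "\<And>r. r \<in> {r. fst r \<noteq> i \<and> snd r \<noteq> i} \<Longrightarrow>
      (\<Sum>l\<in>UNIV. kernel_vec (fst r) $ l * kernel_vec l $ snd r * c l) = 0"
    show "c l = 0"
    proof (rule kernel_weights_eq_0)
      fix w r assume "w \<noteq> i" "r \<noteq> i"
      then show "(\<Sum>l\<in>UNIV. kernel_vec w $ l * kernel_vec l $ r * c l) = 0"
        using homogeneous[of "(w, r)"] by simp
    qed
  qed
  obtain j where "j \<noteq> i" by (metis zero_neq_one)
  have "p j $ l \<in> \<rat>" for l
    using rat[OF \<open>j \<noteq> i\<close>, of l] axis_ratio_rat[of j]
    by (cases "l = j") (auto simp: kernel_vec_def axis_def dest: Rats_add[of _ "1 / \<kappa> j"])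
  moreover have "p j \<noteq> 0" using ex_p_nth_nonzero[of j] by auto
  ultimately show False using irrational p_mem[of j] by (auto simp: totally_irrational_def)
qed

lemma cross2_dir_\<pi>:
  assumes "distinct [a, b, c, i]"
  shows "cross2 (dir i) (\<pi> v) = cross2 (dir i) (\<pi> (axis a 1)) * v $ a +
    cross2 (dir i) (\<pi> (axis b 1)) * v $ b + cross2 (dir i) (\<pi> (axis c 1)) * v $ c"
proof -
  have v: "v = v $ a *\<^sub>R axis a 1 + v $ b *\<^sub>R axis b 1 + v $ c *\<^sub>R axis c 1 + v $ i *\<^sub>R axis i 1"
    unfolding vec_eq_iff all_4_distinct[OF assms] using assms by (auto simp: axis_def)
  have "\<pi> v = v $ a *\<^sub>R \<pi> (axis a 1) + v $ b *\<^sub>R \<pi> (axis b 1) + v $ c *\<^sub>R \<pi> (axis c 1) +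
      v $ i *\<^sub>R \<pi> (axis i 1)"
    by (subst v) (simp only: \<pi>_simps)
  then show ?thesis by (simp add: \<pi>_axis[of i])
qed

lemma kernel_vec_rational_if_lattice_parallel:
  assumes m: "m \<in> integer_lattice" and par: "cross2 (dir i) (\<pi> m) = 0"
    and not_multiple: "\<And>\<rho>. \<exists>l. l \<noteq> i \<and> m $ l \<noteq> \<rho> * p i $ l" and "u \<noteq> i"
  shows "kernel_vec u $ u \<in> \<rat>"
proof -
  obtain b c where "distinct [u, i, b, c]" using obtain_distinct_4 \<open>u \<noteq> i\<close> by metis
  then have dist: "distinct [u, b, c, i]" by auto
  define a :: "real^3" where "a = vector [cross2 (dir i) (\<pi> (axis u 1)),
    cross2 (dir i) (\<pi> (axis b 1)), cross2 (dir i) (\<pi> (axis c 1))]"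
  define R :: "real^4 \<Rightarrow> real^3" where "R v = vector [v $ u, v $ b, v $ c]" for v
  have R_nth: "R v $ 1 = v $ u" "R v $ 2 = v $ b" "R v $ 3 = v $ c" for v
    by (simp_all add: R_def)
  have R_eqD: "v $ l = \<rho> * w $ l" if "R v = \<rho> *\<^sub>R R w" "l \<noteq> i" for v w \<rho> l
  proof -
    have "l = u \<or> l = b \<or> l = c" using UNIV_4_distinct[OF dist] \<open>l \<noteq> i\<close> by blast
    moreover have "R v $ n = \<rho> * R w $ n" for n using that(1) by simp
    ultimately show ?thesis by (metis R_nth)
  qed
  have orth: "a \<bullet> R v = 0" if "cross2 (dir i) (\<pi> v) = 0" for v
    using that cross2_dir_\<pi>[OF dist, of v] by (simp add: inner_vec_def sum_3 R_nth a_def)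
  have "R m \<noteq> \<rho> *\<^sub>R R (p i)" for \<rho>
    using R_eqD[of m \<rho> "p i"] not_multiple[of \<rho>] by metis
  moreover have "R (p i) \<noteq> 0"
    using R_eqD[of "p i" 0 "p i"] ex_p_nth_nonzero[of i] by fastforce
  ultimately have "\<not> collinear {0, R (p i), R m}"
    unfolding collinear_lemma by (metis scaleR_zero_left)
  moreover have "a $ 1 \<noteq> 0"
    using dir_cross[of i u] \<open>u \<noteq> i\<close> by (simp add: a_def \<pi>_axis axis_ratio_nonzero)
  moreover have "R (p i) $ l \<in> \<rat>" "R m $ l \<in> \<rat>" for l
    using p_nth_int[of _ i] m dist exhaust_3[of l] Ints_subset_Rats
    by (auto simp: R_nth integer_lattice_def)
  moreover have "R (kernel_vec u) $ 2 \<in> \<rat>" "R (kernel_vec u) $ 3 \<in> \<rat>"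
    using kernel_vec_nth_int[of _ u] dist Ints_subset_Rats by (auto simp: R_nth)
  ultimately have "R (kernel_vec u) $ 1 \<in> \<rat>"
    by (intro rational_coordinate_of_orthogonal[of a "R (p i)" "R m"] orth)
      (simp_all add: par \<pi>_kernel_vec)
  then show ?thesis by (simp add: R_nth)
qed

theorem lattice_projection_parallel:
  assumes m: "m \<in> integer_lattice" and par: "cross2 (dir i) (\<pi> m) = 0"
  obtains \<rho> c where "m = \<rho> *\<^sub>R p i + c *\<^sub>R axis i 1"
proof (rule ccontr)
  assume "\<not> thesis"
  have not_multiple: "\<exists>l. l \<noteq> i \<and> m $ l \<noteq> \<rho> * p i $ l" for \<rho>
  proof (rule ccontr)
    assume "\<nexists>l. l \<noteq> i \<and> m $ l \<noteq> \<rho> * p i $ l"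
    then have "m = \<rho> *\<^sub>R p i + (m $ i - \<rho> * p i $ i) *\<^sub>R axis i 1"
      by (auto simp: vec_eq_iff axis_def)
    then show False using \<open>\<not> thesis\<close> that by blast
  qed
  have "kernel_vec u $ l \<in> \<rat>" if "u \<noteq> i" for u l
    using kernel_vec_rational_if_lattice_parallel[OF m par not_multiple that]
      kernel_vec_nth_int[of l u] Ints_subset_Rats by (cases "l = u") auto
  then show False using kernel_vec_not_all_rational by blast
qed

lemma lattice_kernel_trivial:
  assumes "m \<in> integer_lattice" "\<pi> m = 0"
  shows "m = 0"
proof (rule ccontr)
  assume "m \<noteq> 0"
  then obtain i where i: "\<And>c. m \<noteq> c *\<^sub>R kernel_vec i" using ex_kernel_vec_not_collinear by blast
  obtain \<rho> c where m: "m = \<rho> *\<^sub>R p i + c *\<^sub>R axis i 1"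
    by (rule lattice_projection_parallel[OF assms(1), of i]) (simp add: assms(2))
  have "m = \<rho> *\<^sub>R kernel_vec i"
  proof (rule kernel_eqI[of _ _ i])
    show "m $ j = (\<rho> *\<^sub>R kernel_vec i) $ j" if "j \<noteq> i" for j
      using that by (simp add: m kernel_vec_nth axis_def)
  qed (simp_all add: assms(2) \<pi>_simps \<pi>_kernel_vec)
  then show False using i by blast
qed

lemma rational_kernel_trivial:
  assumes "\<And>l. v $ l \<in> \<rat>" "\<pi> v = 0"
  shows "v = 0"
proof -
  obtain n :: nat where n: "n \<noteq> 0" "\<And>l. real n * v $ l \<in> \<int>"
    using common_denominator assms(1) by blast
  have "real n *\<^sub>R v = 0"
    using n(2) assms(2)
    by (intro lattice_kernel_trivial) (simp_all add: integer_lattice_def \<pi>_simps)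
  then show ?thesis using n(1) by simp
qed

lemma kernel_vec_pairwise_independent:
  assumes "i \<noteq> j"
  shows "kernel_vec i \<noteq> c *\<^sub>R kernel_vec j"
proof
  assume par: "kernel_vec i = c *\<^sub>R kernel_vec j"
  then have "c \<noteq> 0" using kernel_vec_nonzero[of i] by auto
  have rational: "kernel_vec u $ l \<in> \<rat>" if "l \<noteq> u" for u l
    using kernel_vec_nth_int that Ints_subset_Rats by blast
  obtain l where l: "l \<noteq> i" "l \<noteq> j" "kernel_vec j $ l \<noteq> 0"
    using kernel_eq_0I[OF \<pi>_kernel_vec assms] kernel_vec_nonzero by blast
  then have "c = kernel_vec i $ l / kernel_vec j $ l" using par by simp
  then have "c \<in> \<rat>" using rational l by simp
  moreover have "kernel_vec j $ j = kernel_vec i $ j / c" using par \<open>c \<noteq> 0\<close> by simp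
  ultimately have "kernel_vec j $ j \<in> \<rat>" using rational assms by simp
  then have "kernel_vec j $ m \<in> \<rat>" for m using rational by (cases "m = j") auto
  then show False using rational_kernel_trivial \<pi>_kernel_vec kernel_vec_nonzero by blast
qed

end

section \<open>Tilings by translates of convex prototiles\<close>

definition touching :: "'a set set \<Rightarrow> ('a set \<times> 'a set) set" where
  "touching \<F> = {(A, B). A \<in> \<F> \<and> B \<in> \<F> \<and> A \<inter> B \<noteq> {}}"

lemma touching_mono: "\<F> \<subseteq> \<G> \<Longrightarrow> touching \<F> \<subseteq> touching \<G>"
  by (auto simp: touching_def)

lemma finite_closed_cover_touching:
  assumes "finite \<F>" and closed: "\<And>A. A \<in> \<F> \<Longrightarrow> closed A"
    and S: "connected S" "S \<subseteq> \<Union>\<F>"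
    and A: "A \<in> \<F>" "A \<inter> S \<noteq> {}" and B: "B \<in> \<F>" "B \<inter> S \<noteq> {}"
  shows "(A, B) \<in> (touching \<F>)\<^sup>*"
proof (rule ccontr)
  assume unreachable: "(A, B) \<notin> (touching \<F>)\<^sup>*"
  let ?U = "\<Union>{C \<in> \<F>. (A, C) \<in> (touching \<F>)\<^sup>*}" and ?V = "\<Union>{C \<in> \<F>. (A, C) \<notin> (touching \<F>)\<^sup>*}"
  have "closed ?U" "closed ?V" using assms by auto
  moreover have "S \<subseteq> ?U \<union> ?V" using S(2) by blast
  moreover have "?U \<inter> ?V = {}"
    by (auto simp: touching_def intro: rtrancl_into_rtrancl)
  moreover have "?U \<inter> S \<noteq> {}" using A by blast
  moreover have "?V \<inter> S \<noteq> {}" using B unreachable by blast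
  ultimately show False using connected_closedD[OF S(1), of ?U ?V] by blast
qed

lemma dist_le_relpow:
  fixes f :: "'a \<Rightarrow> 'b::metric_space"
  assumes "(x, y) \<in> r ^^ n" and step: "\<And>a b. (a, b) \<in> r \<Longrightarrow> dist (f a) (f b) \<le> c"
  shows "dist (f x) (f y) \<le> real n * c"
  using assms(1)
proof (induction n arbitrary: y)
  case (Suc n)
  then obtain z where "dist (f x) (f z) \<le> real n * c" "(z, y) \<in> r" by auto
  then show ?case
    using step[of z y] dist_triangle[of "f x" "f y" "f z"] by (simp add: algebra_simps)
qed simp

lemma separated_card_bound:
  fixes r R :: real
  assumes "r > 0"
  obtains N :: nat where "\<And>(z :: 'a::euclidean_space) S. S \<subseteq> cball z R \<Longrightarrow>
    (\<And>x y. x \<in> S \<Longrightarrow> y \<in> S \<Longrightarrow> x \<noteq> y \<Longrightarrow> r \<le> dist x y) \<Longrightarrow> finite S \<and> card S \<le> N"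
proof -
  obtain K :: "'a set" where K: "finite K" "cball 0 R \<subseteq> (\<Union>x\<in>K. ball x (r / 2))"
    using compact_eq_totally_bounded[of "cball (0::'a) R"] \<open>r > 0\<close>
    by (meson compact_cball half_gt_zero)
  have "finite S \<and> card S \<le> card K"
    if S: "S \<subseteq> cball z R" and sep: "\<And>x y. x \<in> S \<Longrightarrow> y \<in> S \<Longrightarrow> x \<noteq> y \<Longrightarrow> r \<le> dist x y" for z :: 'a and S
  proof -
    have "\<exists>k\<in>K. x - z \<in> ball k (r / 2)" if "x \<in> S" for x
    proof -
      have "x - z \<in> cball 0 R" using S that by (auto simp: dist_norm norm_minus_commute)
      then show ?thesis using K(2) by blast
    qed
    then obtain f where f: "\<And>x. x \<in> S \<Longrightarrow> f x \<in> K" "\<And>x. x \<in> S \<Longrightarrow> x - z \<in> ball (f x) (r / 2)" by metis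
    have "inj_on f S"
    proof (rule inj_onI, rule ccontr)
      fix x y assume xy: "x \<in> S" "y \<in> S" "f x = f y" "x \<noteq> y"
      have "dist (f x) (x - z) < r / 2" "dist (f x) (y - z) < r / 2"
        using f(2)[OF xy(1)] f(2)[OF xy(2)] xy(3) by simp_all
      then have "dist (x - z) (y - z) < r" by (rule dist_triangle_half_r)
      then show False using sep[OF xy(1,2,4)] by (simp add: dist_norm)
    qed
    moreover have "f ` S \<subseteq> K" using f(1) by blast
    ultimately show ?thesis using K(1) by (meson card_inj_on_le inj_on_finite)
  qed
  then show ?thesis by (rule that)
qed

locale convex_tiling =
  fixes \<P> \<A> :: "(real^2) set set"
  assumes finite_prototiles: "finite \<P>"
    and prototile: "\<And>P. P \<in> \<P> \<Longrightarrow> compact P \<and> convex P \<and> interior P \<noteq> {}"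
    and tiling: "plane_tiling \<A>"
    and translates: "\<And>A. A \<in> \<A> \<Longrightarrow> \<exists>P\<in>\<P>. \<exists>\<tau>. A = (+) \<tau> ` P"
begin

lemma tile_compact: "A \<in> \<A> \<Longrightarrow> compact A"
  using translates prototile by (metis compact_translation)

lemma tile_closed: "A \<in> \<A> \<Longrightarrow> closed A"
  by (simp add: tile_compact compact_imp_closed)

lemma tile_convex: "A \<in> \<A> \<Longrightarrow> convex A"
  using translates prototile by (metis convex_translation)

lemma tile_nonempty: "A \<in> \<A> \<Longrightarrow> A \<noteq> {}"
  using translates prototile by (metis image_is_empty interior_empty)

lemma cover: "\<exists>A\<in>\<A>. z \<in> A"
  using tiling by (auto simp: plane_tiling_def)

lemma ex_extreme_point: "A \<in> \<A> \<Longrightarrow> \<exists>x. x extreme_point_of A"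
  using extreme_point_exists_convex[OF tile_compact tile_convex tile_nonempty] by metis

lemma tiles_edge_to_edge: "A \<in> \<A> \<Longrightarrow> B \<in> \<A> \<Longrightarrow> A \<noteq> B \<Longrightarrow> edge_to_edge A B"
  using tiling by (auto simp: plane_tiling_def)

lemma common_face:
  assumes "A \<in> \<A>" "B \<in> \<A>" "A \<inter> B \<noteq> {}"
  shows "A \<inter> B face_of A \<and> A \<inter> B face_of B"
proof (cases "A = B")
  case True
  then show ?thesis using tile_convex[OF assms(1)] by (simp add: face_of_refl)
next
  case False
  from tiles_edge_to_edge[OF assms(1,2) this] assms(3)
  consider x where "A \<inter> B = {x}" "x extreme_point_of A" "x extreme_point_of B"
    | "A \<inter> B edge_of A" "A \<inter> B edge_of B"
    unfolding edge_to_edge_def by blast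
  then show ?thesis by cases (simp_all add: edge_of_def face_of_singleton)
qed

lemma extreme_point_of_adjacent_tile:
  assumes "A \<in> \<A>" "B \<in> \<A>" "x extreme_point_of A" "x \<in> B"
  shows "x extreme_point_of B"
proof -
  have x: "x \<in> A \<inter> B" using assms by (auto simp: extreme_point_of_def)
  then have "A \<inter> B face_of B" using common_face[OF assms(1,2)] by blast
  moreover have "x extreme_point_of (A \<inter> B)"
    using assms(3) x by (auto simp: extreme_point_of_def)
  ultimately show ?thesis using extreme_point_of_face by blast
qed

lemma touching_common_vertex:
  assumes "(A, B) \<in> touching \<A>"
  obtains x where "x extreme_point_of A" "x extreme_point_of B"
proof -
  have AB: "A \<in> \<A>" "B \<in> \<A>" "A \<inter> B \<noteq> {}" using assms by (auto simp: touching_def)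
  then have "compact (A \<inter> B)" "convex (A \<inter> B)"
    using tile_compact tile_convex by (auto intro: compact_Int convex_Int)
  then obtain x where "x extreme_point_of (A \<inter> B)"
    using extreme_point_exists_convex AB(3) by metis
  then show ?thesis using that common_face[OF AB] extreme_point_of_face by blast
qed

lemma interior_Int_empty:
  assumes "A \<in> \<A>" "B \<in> \<A>" "A \<noteq> B"
  shows "interior (A \<inter> B) = {}"
proof (rule ccontr)
  assume ne: "interior (A \<inter> B) \<noteq> {}"
  then have "aff_dim (A \<inter> B) = 2" using aff_dim_nonempty_interior[OF ne] by simp
  then show False using tiles_edge_to_edge[OF assms] by (auto simp: edge_to_edge_def edge_of_def)
qed

lemma uniform_inner_ball:
  obtains r where "r > 0" "\<And>A. A \<in> \<A> \<Longrightarrow> \<exists>c. ball c r \<subseteq> A"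
proof -
  have "\<forall>\<^sub>F r in at_right 0. \<exists>c. ball c r \<subseteq> P" if P: "P \<in> \<P>" for P
  proof -
    obtain c e where "e > 0" "ball c e \<subseteq> P"
      using prototile[OF P] by (metis ex_in_conv mem_interior)
    then have "\<exists>c. ball c r \<subseteq> P" if "r < e" for r
      using that by (metis subset_ball order_less_imp_le order_trans)
    then show ?thesis
      using \<open>e > 0\<close> eventually_at_right_less eventually_at_rightI[of 0 e] by auto
  qed
  then have "\<forall>\<^sub>F r in at_right (0::real). \<forall>P\<in>\<P>. \<exists>c. ball c r \<subseteq> P"
    by (intro eventually_ball_finite finite_prototiles) blast
  then obtain r :: real where r: "r > 0" "\<And>P. P \<in> \<P> \<Longrightarrow> \<exists>c. ball c r \<subseteq> P"
    using eventually_happens'[OF trivial_limit_at_right_real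
      eventually_conj[OF _ eventually_at_right_less]] by blast
  have "\<exists>c. ball c r \<subseteq> A" if "A \<in> \<A>" for A
    using translates[OF that] r(2) by (metis ball_translation image_mono)
  then show ?thesis by (rule that[OF r(1)])
qed

lemma uniform_diameter:
  obtains D where "\<And>A x y. A \<in> \<A> \<Longrightarrow> x \<in> A \<Longrightarrow> y \<in> A \<Longrightarrow> dist x y \<le> D"
proof -
  have "dist x y \<le> (\<Sum>P\<in>\<P>. diameter P)" if A: "A \<in> \<A>" "x \<in> A" "y \<in> A" for A x y
  proof -
    obtain P \<tau> where P: "P \<in> \<P>" "A = (+) \<tau> ` P" using translates[OF A(1)] by blast
    then obtain u v where uv: "x = \<tau> + u" "u \<in> P" "y = \<tau> + v" "v \<in> P" using A by blast
    have "bounded Q" if "Q \<in> \<P>" for Q using prototile[OF that] by (simp add: compact_imp_bounded)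
    then have "dist u v \<le> diameter P" "diameter P \<le> (\<Sum>P\<in>\<P>. diameter P)"
      using P(1) uv finite_prototiles
      by (auto intro: diameter_bounded_bound member_le_sum diameter_ge_0)
    then show ?thesis using uv by simp
  qed
  then show ?thesis by (rule that)
qed

lemma local_card_bound:
  fixes R :: real
  obtains N where "\<And>z. finite {A \<in> \<A>. A \<inter> cball z R \<noteq> {}} \<and> card {A \<in> \<A>. A \<inter> cball z R \<noteq> {}} \<le> N"
proof -
  obtain r where r: "r > 0" "\<And>A. A \<in> \<A> \<Longrightarrow> \<exists>c. ball c r \<subseteq> A" using uniform_inner_ball by blast
  then obtain c where inner: "\<And>A. A \<in> \<A> \<Longrightarrow> ball (c A) r \<subseteq> A" by metis
  obtain D where D: "\<And>A x y. A \<in> \<A> \<Longrightarrow> x \<in> A \<Longrightarrow> y \<in> A \<Longrightarrow> dist x y \<le> D" using uniform_diameter by blast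
  obtain N where N: "\<And>(z :: real^2) S. S \<subseteq> cball z (R + D) \<Longrightarrow>
    (\<And>x y. x \<in> S \<Longrightarrow> y \<in> S \<Longrightarrow> x \<noteq> y \<Longrightarrow> r \<le> dist x y) \<Longrightarrow> finite S \<and> card S \<le> N"
    by (rule separated_card_bound[OF r(1), of "R + D"]) blast
  have sep: "r \<le> dist (c A) (c B)" if "A \<in> \<A>" "B \<in> \<A>" "A \<noteq> B" for A B
  proof (rule ccontr)
    assume "\<not> r \<le> dist (c A) (c B)"
    then have "c A \<in> ball (c A) r \<inter> ball (c B) r" using r(1) by (simp add: dist_commute)
    moreover have "ball (c A) r \<inter> ball (c B) r \<subseteq> interior (A \<inter> B)"
      using inner that by (intro interior_maximal) auto
    ultimately show False using interior_Int_empty[OF that] by blast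
  qed
  have "finite {A \<in> \<A>. A \<inter> cball z R \<noteq> {}} \<and> card {A \<in> \<A>. A \<inter> cball z R \<noteq> {}} \<le> N" for z
  proof -
    let ?\<F> = "{A \<in> \<A>. A \<inter> cball z R \<noteq> {}}"
    have inj: "inj_on c ?\<F>" using sep r(1) by (force simp: inj_on_def)
    have "c ` ?\<F> \<subseteq> cball z (R + D)"
    proof
      fix y assume "y \<in> c ` ?\<F>"
      then obtain A where y: "y = c A" and "A \<in> ?\<F>" by blast
      then obtain x where A: "A \<in> \<A>" "x \<in> A" "dist z x \<le> R" by auto
      have "c A \<in> A" using inner[OF A(1)] r(1) by auto
      then have "dist x (c A) \<le> D" using D A by blast
      then show "y \<in> cball z (R + D)" using A(3) dist_triangle[of z "c A" x] y by simp
    qed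
    then have "finite (c ` ?\<F>) \<and> card (c ` ?\<F>) \<le> N"
      using sep by (intro N) blast+
    then show ?thesis using inj by (simp add: card_image finite_image_iff)
  qed
  then show ?thesis by (rule that)
qed

lemma tile_in_direction:
  assumes "v \<noteq> 0"
  obtains A s where "A \<in> \<A>" "z \<in> A" "s \<noteq> 0" "z + s *\<^sub>R v \<in> A"
proof -
  let ?\<F> = "{A \<in> \<A>. A \<inter> cball z 1 \<noteq> {}}"
  have fin: "finite ?\<F>" by (rule local_card_bound[of 1]) blast
  let ?U = "\<Union>{A \<in> ?\<F>. z \<notin> A}"
  have "closed ?U"
    by (rule closed_Union) (use fin tile_closed in \<open>auto intro: finite_subset[of _ ?\<F>]\<close>)
  then obtain e where e: "e > 0" "ball z e \<subseteq> - ?U"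
    by (rule openE[of "- ?U" z, OF open_Compl]) auto
  define s where "s = min 1 (e / 2) / norm v"
  have "s \<noteq> 0" using e(1) assms by (simp add: s_def)
  have "norm (s *\<^sub>R v) = min 1 (e / 2)" using assms e(1) by (simp add: s_def)
  then have near: "dist z (z + s *\<^sub>R v) \<le> 1" "dist z (z + s *\<^sub>R v) < e"
    using e(1) by (auto simp: dist_norm)
  obtain A where A: "A \<in> \<A>" "z + s *\<^sub>R v \<in> A" using cover by blast
  then have "A \<in> ?\<F>" using near(1) by auto
  moreover have "z + s *\<^sub>R v \<in> - ?U" using near(2) by (intro subsetD[OF e(2)]) simp
  ultimately have "z \<in> A" using A(2) by blast
  then show ?thesis using that A \<open>s \<noteq> 0\<close> by blast
qed

lemma touching_near:
  assumes "A \<in> \<A>" "B \<in> \<A>" "x \<in> A" "y \<in> B" "dist x y \<le> R"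
  shows "(A, B) \<in> (touching {A \<in> \<A>. A \<inter> cball x R \<noteq> {}})\<^sup>*"
proof (rule finite_closed_cover_touching)
  let ?\<F> = "{A \<in> \<A>. A \<inter> cball x R \<noteq> {}}"
  have "0 \<le> R" using assms(5) zero_le_dist[of x y] by linarith
  then have seg: "closed_segment x y \<subseteq> cball x R"
    using assms(5) by (intro closed_segment_subset) auto
  show "connected (closed_segment x y)" by simp
  show "closed_segment x y \<subseteq> \<Union>?\<F>" using seg cover by blast
  show "A \<in> ?\<F>" "B \<in> ?\<F>" using assms \<open>0 \<le> R\<close> by auto
  show "A \<inter> closed_segment x y \<noteq> {}" "B \<inter> closed_segment x y \<noteq> {}" using assms by auto
  show "finite ?\<F>" by (rule local_card_bound[of R]) blast
qed (use tile_closed in auto)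

lemma touching_connected:
  assumes "A \<in> \<A>" "B \<in> \<A>"
  shows "(A, B) \<in> (touching \<A>)\<^sup>*"
proof -
  obtain x y where "x \<in> A" "y \<in> B" using tile_nonempty assms by blast
  then have "(A, B) \<in> (touching {A \<in> \<A>. A \<inter> cball x (dist x y) \<noteq> {}})\<^sup>*"
    using assms by (intro touching_near) auto
  then show ?thesis by (rule rtrancl_mono[OF touching_mono, THEN subsetD, rotated]) blast
qed

lemma touching_chain_bound:
  fixes R :: real
  obtains N :: nat where "\<And>A B x y. A \<in> \<A> \<Longrightarrow> B \<in> \<A> \<Longrightarrow> x \<in> A \<Longrightarrow> y \<in> B \<Longrightarrow> dist x y \<le> R \<Longrightarrow>
    \<exists>n\<le>N. (A, B) \<in> touching \<A> ^^ n"
proof -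
  obtain N where N: "\<And>z. finite {A \<in> \<A>. A \<inter> cball z R \<noteq> {}} \<and> card {A \<in> \<A>. A \<inter> cball z R \<noteq> {}} \<le> N"
    by (rule local_card_bound[of R]) blast
  have "\<exists>n\<le>N * N. (A, B) \<in> touching \<A> ^^ n"
    if AB: "A \<in> \<A>" "B \<in> \<A>" "x \<in> A" "y \<in> B" "dist x y \<le> R" for A B x y
  proof -
    let ?\<F> = "{A \<in> \<A>. A \<inter> cball x R \<noteq> {}}"
    have sub: "touching ?\<F> \<subseteq> ?\<F> \<times> ?\<F>" by (auto simp: touching_def)
    then have fin: "finite (touching ?\<F>)" using N by (meson finite_SigmaI finite_subset)
    then obtain n where n: "n \<le> card (touching ?\<F>)" "(A, B) \<in> touching ?\<F> ^^ n"
      using touching_near[OF AB] rtrancl_finite_eq_relpow by auto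
    have "card (touching ?\<F>) \<le> card ?\<F> * card ?\<F>"
      using card_mono[OF _ sub] N by (simp add: card_cartesian_product)
    also have "\<dots> \<le> N * N" using N by (intro mult_le_mono) auto
    finally have "n \<le> N * N" using n(1) by simp
    moreover have "(A, B) \<in> touching \<A> ^^ n"
      using n(2) by (rule relpowp_mono[to_set, rotated]) (auto simp: touching_def)
    ultimately show ?thesis by blast
  qed
  then show ?thesis by (rule that)
qed

end

section \<open>Lifting tilings by parallelograms\<close>

lemma parallelogram_interior_nonempty:
  assumes lin: "linear \<pi>" and "cross2 (\<pi> (axis i 1)) (\<pi> (axis j 1)) \<noteq> 0"
  shows "interior (\<pi> ` two_face 0 i j) \<noteq> {}"
proof
  assume "interior (\<pi> ` two_face 0 i j) = {}"
  moreover have "convex (\<pi> ` two_face 0 i j)"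
    unfolding two_face_eq_convex_hull using lin by (simp add: convex_linear_image)
  ultimately obtain a b where a: "a \<noteq> 0" "\<pi> ` two_face 0 i j \<subseteq> {x. a \<bullet> x = b}"
    using empty_interior_subset_hyperplane by metis
  have "a \<bullet> \<pi> m = b" if "m \<in> face_corners 0 i j" for m
    using a(2) that face_corners_subset_two_face by blast
  from this[of 0] this[of "axis i 1"] this[of "axis j 1"]
  have "a \<bullet> \<pi> (axis i 1) = 0" "a \<bullet> \<pi> (axis j 1) = 0"
    by (simp_all add: face_corners_def linear_0[OF lin])
  moreover obtain \<alpha> \<beta> where "a = \<alpha> *\<^sub>R \<pi> (axis i 1) + \<beta> *\<^sub>R \<pi> (axis j 1)"
    using cramer2[OF assms(2), of a] by blast
  then have "a \<bullet> a = \<alpha> * (a \<bullet> \<pi> (axis i 1)) + \<beta> * (a \<bullet> \<pi> (axis j 1))"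
    by (metis inner_add_right inner_scaleR_right)
  ultimately show False using a(1) by simp
qed

lemma extreme_point_of_projected_face:
  assumes lin: "linear \<pi>" and "y extreme_point_of (+) \<tau> ` \<pi> ` two_face x i j"
  obtains m where "m \<in> face_corners x i j" "y = \<tau> + \<pi> m"
proof -
  have "(+) \<tau> ` \<pi> ` two_face x i j = convex hull ((+) \<tau> ` \<pi> ` face_corners x i j)"
    by (simp add: two_face_eq_convex_hull convex_hull_linear_image[OF lin] convex_hull_translation)
  then have "y \<in> (+) \<tau> ` \<pi> ` face_corners x i j"
    using assms(2) extreme_point_of_convex_hull by metis
  then show ?thesis using that by blast
qed

definition translation_invariant :: "'a::real_vector \<Rightarrow> 'a set set \<Rightarrow> bool" where
  "translation_invariant t \<A> \<longleftrightarrow> (\<lambda>A. (+) t ` A) ` \<A> = \<A>"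

lemma translation_invariant_add:
  "translation_invariant t \<A> \<Longrightarrow> translation_invariant u \<A> \<Longrightarrow> translation_invariant (t + u) \<A>"
  unfolding translation_invariant_def
  by (metis (no_types, lifting) image_cong image_image add.assoc)

lemma translation_invariant_minus:
  assumes "translation_invariant t \<A>"
  shows "translation_invariant (- t) \<A>"
proof -
  have "(\<lambda>A. (+) (- t) ` A) ` \<A> = (\<lambda>A. (+) (- t) ` A) ` (\<lambda>A. (+) t ` A) ` \<A>"
    using assms by (simp add: translation_invariant_def)
  also have "\<dots> = \<A>" by (simp add: image_image)
  finally show ?thesis by (simp add: translation_invariant_def)
qed

lemma translation_invariant_int_multiple:
  assumes "translation_invariant t \<A>"
  shows "translation_invariant (of_int n *\<^sub>R t) \<A>"
proof (induction n rule: int_induct[where k = 0])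
  case base
  then show ?case by (simp add: translation_invariant_def)
next
  case (step1 n)
  then show ?case using translation_invariant_add[OF assms step1(2)] by (simp add: algebra_simps)
next
  case (step2 n)
  then show ?case
    using translation_invariant_add[OF translation_invariant_minus[OF assms] step2(2)]
    by (simp add: algebra_simps)
qed

lemma translation_invariantD: "translation_invariant t \<A> \<Longrightarrow> A \<in> \<A> \<Longrightarrow> (+) t ` A \<in> \<A>"
  by (auto simp: translation_invariant_def)

locale parallelogram_tiling =
  fixes \<pi> :: "real^4 \<Rightarrow> real^2" and \<A> :: "(real^2) set set"
  assumes lin: "linear \<pi>"
    and cross_axis: "\<And>i j. i \<noteq> j \<Longrightarrow> cross2 (\<pi> (axis i 1)) (\<pi> (axis j 1)) \<noteq> 0"
    and plane_tiling: "plane_tiling \<A>"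
    and tiles: "\<And>A. A \<in> \<A> \<Longrightarrow> \<exists>\<tau> i j. i \<noteq> j \<and> A = (+) \<tau> ` \<pi> ` two_face 0 i j"
begin

sublocale convex_tiling "{\<pi> ` two_face 0 i j | i j. i \<noteq> j}" \<A>
proof
  have "{\<pi> ` two_face 0 i j | i j. i \<noteq> j} \<subseteq> range (\<lambda>(i, j). \<pi> ` two_face 0 i j)" by auto
  then show "finite {\<pi> ` two_face 0 i j | i j. i \<noteq> j}" by (rule finite_subset) simp
  fix P assume "P \<in> {\<pi> ` two_face 0 i j | i j. i \<noteq> j}"
  then obtain i j where P: "i \<noteq> j" "P = \<pi> ` two_face 0 i j" by blast
  then have "P = convex hull (\<pi> ` face_corners 0 i j)"
    by (simp add: two_face_eq_convex_hull convex_hull_linear_image[OF lin])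
  then have "compact P" "convex P"
    by (simp_all add: face_corners_def finite_imp_compact_convex_hull)
  then show "compact P \<and> convex P \<and> interior P \<noteq> {}"
    using parallelogram_interior_nonempty[OF lin cross_axis[OF P(1)]] P(2) by simp
next
  show "\<exists>P\<in>{\<pi> ` two_face 0 i j | i j. i \<noteq> j}. \<exists>\<tau>. A = (+) \<tau> ` P" if "A \<in> \<A>" for A
    using tiles[OF that] by blast
qed (rule plane_tiling)

lemma extreme_points_difference:
  assumes "A \<in> \<A>" "y extreme_point_of A" "y' extreme_point_of A"
  obtains m where "m \<in> integer_lattice" "norm m \<le> 4" "y = y' + \<pi> m"
proof -
  obtain \<tau> i j where A: "A = (+) \<tau> ` \<pi> ` two_face 0 i j" using tiles[OF assms(1)] by blast
  obtain n where n: "n \<in> face_corners 0 i j" "y = \<tau> + \<pi> n"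
    using extreme_point_of_projected_face[OF lin] assms(2) unfolding A by blast
  obtain n' where n': "n' \<in> face_corners 0 i j" "y' = \<tau> + \<pi> n'"
    using extreme_point_of_projected_face[OF lin] assms(3) unfolding A by blast
  show ?thesis
  proof
    show "n - n' \<in> integer_lattice"
      using n(1) n'(1) face_corners_integral[OF integer_lattice_zero] integer_lattice_diff by blast
    show "norm (n - n') \<le> 4" by (rule norm_face_corners_diff_le[OF n(1) n'(1)])
    show "y = y' + \<pi> (n - n')" by (simp add: n n' linear_diff[OF lin])
  qed
qed

end

locale lifted_tiling = parallelogram_tiling +
  fixes x0 :: "real^2"
  assumes lattice_inj: "\<And>m. m \<in> integer_lattice \<Longrightarrow> \<pi> m = 0 \<Longrightarrow> m = 0"
    and x0: "x0 \<in> tiling_vertices \<A>"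
begin

lemma extreme_point_is_vertex: "A \<in> \<A> \<Longrightarrow> x extreme_point_of A \<Longrightarrow> x \<in> tiling_vertices \<A>"
  by (auto simp: tiling_vertices_def)

lemma ex_lattice_coordinates:
  assumes "x \<in> tiling_vertices \<A>"
  shows "\<exists>m. m \<in> integer_lattice \<and> x = x0 + \<pi> m"
proof -
  obtain A where A: "A \<in> \<A>" "x0 extreme_point_of A" using x0 by (auto simp: tiling_vertices_def)
  obtain B where B: "B \<in> \<A>" "x extreme_point_of B" using assms by (auto simp: tiling_vertices_def)
  have move: "\<exists>m. m \<in> integer_lattice \<and> y = x0 + \<pi> m"
    if tile: "A \<in> \<A>" "z extreme_point_of A" "y extreme_point_of A"
      and n: "n \<in> integer_lattice" "z = x0 + \<pi> n" for A y z n
  proof -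
    obtain m where "m \<in> integer_lattice" "y = z + \<pi> m"
      using extreme_points_difference[OF tile(1,3,2)] by blast
    then show ?thesis
      using n by (intro exI[of _ "n + m"]) (simp add: integer_lattice_add linear_add[OF lin])
  qed
  have "\<forall>y. y extreme_point_of B \<longrightarrow> (\<exists>m. m \<in> integer_lattice \<and> y = x0 + \<pi> m)"
    using touching_connected[OF A(1) B(1)]
  proof (induction rule: rtrancl_induct)
    case base
    show ?case
      using move[OF A _ integer_lattice_zero] by (simp add: linear_0[OF lin])
  next
    case (step B C)
    obtain z where z: "z extreme_point_of B" "z extreme_point_of C"
      by (rule touching_common_vertex[OF step(2)])
    have "C \<in> \<A>" using step(2) by (simp add: touching_def)
    then show ?case using step.IH z move by blast
  qed
  then show ?thesis using B(2) by blast
qed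

definition lift :: "real^2 \<Rightarrow> real^4" where
  "lift x = (SOME m. m \<in> integer_lattice \<and> x = x0 + \<pi> m)"

lemma lift:
  assumes "x \<in> tiling_vertices \<A>"
  shows "lift x \<in> integer_lattice" "x = x0 + \<pi> (lift x)"
  using someI_ex[OF ex_lattice_coordinates[OF assms]] unfolding lift_def by blast+

lemma lift_eqI:
  assumes "x \<in> tiling_vertices \<A>" "m \<in> integer_lattice" "x = x0 + \<pi> m"
  shows "lift x = m"
proof -
  have "\<pi> (lift x - m) = 0"
    using lift(2)[OF assms(1)] assms(3) by (simp add: linear_diff[OF lin])
  then show ?thesis
    using lattice_inj[of "lift x - m"] integer_lattice_diff lift(1)[OF assms(1)] assms(2) by simp
qed

lemma lift_add:
  assumes "x \<in> tiling_vertices \<A>" "y \<in> tiling_vertices \<A>" "m \<in> integer_lattice" "y = x + \<pi> m"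
  shows "lift y = lift x + m"
proof (rule lift_eqI[OF assms(2)])
  show "lift x + m \<in> integer_lattice"
    by (rule integer_lattice_add[OF lift(1)[OF assms(1)] assms(3)])
  show "y = x0 + \<pi> (lift x + m)"
    using lift(2)[OF assms(1)] assms(4) by (simp add: linear_add[OF lin])
qed

lemma lift_same_tile:
  assumes "A \<in> \<A>" "y extreme_point_of A" "y' extreme_point_of A"
  shows "dist (lift y) (lift y') \<le> 4"
proof -
  obtain m where m: "m \<in> integer_lattice" "norm m \<le> 4" "y = y' + \<pi> m"
    by (rule extreme_points_difference[OF assms])
  have "lift y = lift y' + m"
    using assms m by (intro lift_add extreme_point_is_vertex)
  then show ?thesis using m(2) by (simp add: dist_norm)
qed

lemma lift_touching:
  assumes "(A, B) \<in> touching \<A>" "y extreme_point_of A" "y' extreme_point_of B"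
  shows "dist (lift y) (lift y') \<le> 8"
proof -
  obtain z where z: "z extreme_point_of A" "z extreme_point_of B"
    by (rule touching_common_vertex[OF assms(1)])
  have "A \<in> \<A>" "B \<in> \<A>" using assms(1) by (auto simp: touching_def)
  then have "dist (lift y) (lift z) \<le> 4" "dist (lift z) (lift y') \<le> 4"
    using lift_same_tile assms z by blast+
  then show ?thesis using dist_triangle[of "lift y" "lift y'" "lift z"] by linarith
qed

definition point_lift :: "real^2 \<Rightarrow> real^4" where
  "point_lift z = lift (SOME y. \<exists>A\<in>\<A>. z \<in> A \<and> y extreme_point_of A)"

lemma point_lift_obtain:
  obtains A y where "A \<in> \<A>" "z \<in> A" "y extreme_point_of A" "point_lift z = lift y"
proof -
  have "\<exists>y. \<exists>A\<in>\<A>. z \<in> A \<and> y extreme_point_of A" using cover ex_extreme_point by metis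
  from someI_ex[OF this] show ?thesis using that unfolding point_lift_def by blast
qed

lemma point_lift_near:
  assumes "A \<in> \<A>" "z \<in> A" "y extreme_point_of A"
  shows "dist (point_lift z) (lift y) \<le> 8"
proof -
  obtain B y' where B: "B \<in> \<A>" "z \<in> B" "y' extreme_point_of B" "point_lift z = lift y'"
    by (rule point_lift_obtain)
  have "(B, A) \<in> touching \<A>" using assms B by (auto simp: touching_def)
  then show ?thesis using lift_touching assms(3) B(3,4) by simp
qed

lemma point_lift_coarse_lipschitz:
  fixes R :: real
  obtains C where "\<And>z z'. dist z z' \<le> R \<Longrightarrow> dist (point_lift z) (point_lift z') \<le> C"
proof -
  obtain N :: nat where N: "\<And>A B x y. A \<in> \<A> \<Longrightarrow> B \<in> \<A> \<Longrightarrow> x \<in> A \<Longrightarrow> y \<in> B \<Longrightarrow> dist x y \<le> R \<Longrightarrow>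
    \<exists>n\<le>N. (A, B) \<in> touching \<A> ^^ n"
    by (rule touching_chain_bound[of R]) blast
  obtain e where e: "\<And>A. A \<in> \<A> \<Longrightarrow> e A extreme_point_of A" using ex_extreme_point by metis
  have step: "dist (lift (e A)) (lift (e B)) \<le> 8" if "(A, B) \<in> touching \<A>" for A B
  proof -
    have "A \<in> \<A>" "B \<in> \<A>" using that by (auto simp: touching_def)
    then show ?thesis using lift_touching[OF that] e by blast
  qed
  have "dist (point_lift z) (point_lift z') \<le> 8 + real N * 8 + 8" if near: "dist z z' \<le> R" for z z'
  proof -
    obtain A B where AB: "A \<in> \<A>" "z \<in> A" "B \<in> \<A>" "z' \<in> B" using cover by metis
    obtain n where n: "n \<le> N" "(A, B) \<in> touching \<A> ^^ n" using N[OF AB(1,3,2,4) near] by blast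
    have "dist (lift (e A)) (lift (e B)) \<le> real n * 8"
      using n(2) step by (rule dist_le_relpow[where f = "\<lambda>A. lift (e A)"])
    also have "\<dots> \<le> real N * 8" using n(1) by simp
    finally have "dist (lift (e A)) (lift (e B)) \<le> real N * 8" .
    moreover have "dist (point_lift z) (lift (e A)) \<le> 8" "dist (point_lift z') (lift (e B)) \<le> 8"
      using point_lift_near AB e by blast+
    ultimately show ?thesis
      using dist_triangle[of "point_lift z" "point_lift z'" "lift (e A)"]
        dist_triangle[of "lift (e A)" "point_lift z'" "lift (e B)"] by (simp add: dist_commute)
  qed
  then show ?thesis by (rule that)
qed

lemma point_lift_translate:
  assumes "translation_invariant (\<pi> q) \<A>" "q \<in> integer_lattice"
  shows "dist (point_lift (z + \<pi> q)) (point_lift z + q) \<le> 8"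
proof -
  obtain A y where A: "A \<in> \<A>" "z \<in> A" "y extreme_point_of A" "point_lift z = lift y"
    by (rule point_lift_obtain)
  let ?B = "(+) (\<pi> q) ` A"
  have B: "?B \<in> \<A>" "z + \<pi> q \<in> ?B" "y + \<pi> q extreme_point_of ?B"
    using A translation_invariantD[OF assms(1)]
    by (simp_all add: add.commute[of _ "\<pi> q"] extreme_point_of_translation_eq)
  have "lift (y + \<pi> q) = lift y + q"
    using extreme_point_is_vertex[OF A(1,3)] extreme_point_is_vertex[OF B(1,3)] assms(2)
    by (rule lift_add) simp
  then show ?thesis using point_lift_near[OF B] A(4) by simp
qed

theorem point_lift_coarsely_equivariant:
  assumes "translation_invariant (\<pi> q) \<A>" "q \<in> integer_lattice"
  obtains C where "\<And>z r. norm (point_lift (z + r *\<^sub>R \<pi> q) - point_lift z - r *\<^sub>R q) \<le> C"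
proof -
  obtain C where C: "\<And>z z'. dist z z' \<le> norm (\<pi> q) \<Longrightarrow> dist (point_lift z) (point_lift z') \<le> C"
    by (rule point_lift_coarse_lipschitz[of "norm (\<pi> q)"]) blast
  have "norm (point_lift (z + r *\<^sub>R \<pi> q) - point_lift z - r *\<^sub>R q) \<le> C + 8 + norm q" for z r
  proof -
    define n where "n = real_of_int \<lfloor>r\<rfloor>"
    have frac: "\<bar>r - n\<bar> \<le> 1" unfolding n_def by linarith
    have "dist (z + r *\<^sub>R \<pi> q) (z + n *\<^sub>R \<pi> q) = \<bar>r - n\<bar> * norm (\<pi> q)"
      by (simp add: dist_norm flip: scaleR_diff_left)
    also have "\<dots> \<le> norm (\<pi> q)" using mult_right_mono[OF frac, of "norm (\<pi> q)"] by simp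
    finally have "dist (point_lift (z + r *\<^sub>R \<pi> q)) (point_lift (z + n *\<^sub>R \<pi> q)) \<le> C" by (rule C)
    moreover have "dist (point_lift (z + \<pi> (n *\<^sub>R q))) (point_lift z + n *\<^sub>R q) \<le> 8"
      using translation_invariant_int_multiple[OF assms(1), of "\<lfloor>r\<rfloor>"] assms(2)
      by (intro point_lift_translate)
        (simp_all add: n_def linear_scale[OF lin] integer_lattice_scale)
    moreover have "dist (point_lift z + n *\<^sub>R q) (point_lift z + r *\<^sub>R q) \<le> norm q"
      using mult_right_mono[OF frac, of "norm q"]
      by (simp add: dist_norm abs_minus_commute flip: scaleR_diff_left)
    ultimately have "dist (point_lift (z + r *\<^sub>R \<pi> q)) (point_lift z + r *\<^sub>R q) \<le> C + 8 + norm q"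
      by (smt (verit) dist_triangle linear_scale[OF lin])
    then show ?thesis by (simp add: dist_norm algebra_simps)
  qed
  then show ?thesis by (rule that)
qed

end

section \<open>Coarsely linear functions\<close>

lemma bounded_range_comp: "bounded (range f) \<Longrightarrow> bounded (range (\<lambda>x. f (h x)))"
  by (erule bounded_subset) auto

lemma bounded_multiples_imp_eq_0:
  fixes v :: "'a::real_normed_vector"
  assumes "bounded (range (\<lambda>s::real. s *\<^sub>R v))"
  shows "v = 0"
proof (rule ccontr)
  assume "v \<noteq> 0"
  obtain C where "\<And>s::real. norm (s *\<^sub>R v) \<le> C" using assms by (auto simp: bounded_iff)
  from this[of "(\<bar>C\<bar> + 1) / norm v"] show False using \<open>v \<noteq> 0\<close> by simp
qed

lemma multiples_near_line_imp_collinear: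
  fixes g k :: "'a::real_inner"
  assumes "bounded (range (\<lambda>s. s *\<^sub>R g - l s *\<^sub>R k))"
  shows "\<exists>\<mu>. g = \<mu> *\<^sub>R k"
proof -
  define v where "v = g - ((g \<bullet> k) / (k \<bullet> k)) *\<^sub>R k"
  have "k \<bullet> v = 0" by (simp add: v_def inner_diff_right inner_commute)
  then have "g \<bullet> v = v \<bullet> v" by (simp add: v_def inner_diff_left)
  then have "(s *\<^sub>R g - l s *\<^sub>R k) \<bullet> v = s *\<^sub>R (v \<bullet> v)" for s
    using \<open>k \<bullet> v = 0\<close> by (simp add: inner_diff_left)
  then have "bounded (range (\<lambda>s. s *\<^sub>R (v \<bullet> v)))"
    using bounded_linear_image[OF assms bounded_linear_inner_left[of v]] by (simp add: image_image)
  then have "v \<bullet> v = 0" by (rule bounded_multiples_imp_eq_0)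
  then show ?thesis by (auto simp: v_def)
qed

lemma bounded_oblique_shift:
  fixes H :: "real^2 \<Rightarrow> 'a::real_normed_vector"
  assumes period: "\<And>z r. norm (H (z + r *\<^sub>R t) - H z - r *\<^sub>R w) \<le> C" and "cross2 u t \<noteq> 0"
  shows "bounded (range (\<lambda>s. H (x0 + s *\<^sub>R x) - H (x0 + (s * (cross2 x t / cross2 u t)) *\<^sub>R u) -
    (s * (cross2 u x / cross2 u t)) *\<^sub>R w))"
proof -
  have "x0 + s *\<^sub>R x =
      (x0 + (s * (cross2 x t / cross2 u t)) *\<^sub>R u) + (s * (cross2 u x / cross2 u t)) *\<^sub>R t" for s
    using arg_cong[OF cramer2[OF assms(2), of x], of "\<lambda>y. x0 + s *\<^sub>R y"] by (simp add: algebra_simps)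
  then have "norm (H (x0 + s *\<^sub>R x) - H (x0 + (s * (cross2 x t / cross2 u t)) *\<^sub>R u) -
      (s * (cross2 u x / cross2 u t)) *\<^sub>R w) \<le> C" for s
    by (simp only: period)
  then show ?thesis by (auto simp: bounded_iff)
qed

lemma coarsely_linear_coefficient:
  fixes k k' w :: "'a::euclidean_space" and \<alpha> :: real
  assumes bounded: "bounded (range (\<lambda>s. b s *\<^sub>R k' - a (s * \<alpha>) *\<^sub>R k - (s * \<beta>) *\<^sub>R w))" and "\<alpha> \<noteq> 0"
    and indep: "independent {k, k'}" "k \<noteq> k'"
  obtains c where "bounded (range (\<lambda>s. s * c - a s))"
proof -
  obtain f :: "'a \<Rightarrow> real" where f: "linear f" "f k = 1" "f k' = 0"
    using linear_independent_extend[OF indep(1), of "\<lambda>x. if x = k then 1 else 0"] indep(2) by auto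
  define c where "c = - (\<beta> * f w) / \<alpha>"
  from bounded_linear_image[OF bounded linear_linear[THEN iffD2, OF f(1)]]
  have "bounded (range (\<lambda>s. - a (s * \<alpha>) - s * \<beta> * f w))"
    by (simp add: image_image linear_diff[OF f(1)] linear_scale[OF f(1)] f(2,3))
  from bounded_range_comp[OF this, of "\<lambda>s. s / \<alpha>"]
  have "bounded (range (\<lambda>s. s * c - a s))"
    using \<open>\<alpha> \<noteq> 0\<close> by (simp add: c_def mult.assoc minus_diff_commute)
  then show ?thesis by (rule that)
qed

text \<open>Coarse linearity along \<open>t\<close> relates the values along \<open>u\<close> to those along \<open>v\<close>, and the independence
  of \<open>k\<close> and \<open>k'\<close> then determines \<open>a\<close> up to a bounded error.\<close>

lemma coarsely_linear_if_near_two_lines: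
  fixes H :: "real^2 \<Rightarrow> 'a::euclidean_space"
  assumes period: "\<And>z r. norm (H (z + r *\<^sub>R t) - H z - r *\<^sub>R w) \<le> C"
    and u: "cross2 u t \<noteq> 0" "bounded (range (\<lambda>s. H (x0 + s *\<^sub>R u) - a s *\<^sub>R k))"
    and v: "cross2 v t \<noteq> 0" "bounded (range (\<lambda>s. H (x0 + s *\<^sub>R v) - b s *\<^sub>R k'))"
    and indep: "independent {k, k'}" "k \<noteq> k'"
  obtains g where "linear g" "g t = w" "\<And>x. bounded (range (\<lambda>s. H (x0 + s *\<^sub>R x) - s *\<^sub>R g x))"
proof -
  define \<alpha> where "\<alpha> x = cross2 x t / cross2 u t" for x
  define \<beta> where "\<beta> x = cross2 u x / cross2 u t" for x
  have shift: "bounded (range (\<lambda>s.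
      H (x0 + s *\<^sub>R x) - H (x0 + (s * \<alpha> x) *\<^sub>R u) - (s * \<beta> x) *\<^sub>R w))" for x
    unfolding \<alpha>_def \<beta>_def using period u(1) by (rule bounded_oblique_shift)
  have "\<alpha> v \<noteq> 0" using u(1) v(1) by (simp add: \<alpha>_def)
  have "bounded (range (\<lambda>s. b s *\<^sub>R k' - a (s * \<alpha> v) *\<^sub>R k - (s * \<beta> v) *\<^sub>R w))"
    using bounded_plus_comp[OF bounded_minus_comp[OF shift[of v] v(2)]
        bounded_range_comp[OF u(2), of "\<lambda>s. s * \<alpha> v"]]
    by (simp add: algebra_simps)
  then obtain c where "bounded (range (\<lambda>s. s * c - a s))"
    using \<open>\<alpha> v \<noteq> 0\<close> indep by (rule coarsely_linear_coefficient)
  from bounded_linear_image[OF this bounded_linear_scaleR_left[of k]]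
  have "bounded (range (\<lambda>s. (s * c) *\<^sub>R k - a s *\<^sub>R k))"
    by (simp add: image_image scaleR_diff_left)
  from bounded_minus_comp[OF u(2) this]
  have along: "bounded (range (\<lambda>s. H (x0 + s *\<^sub>R u) - (s * c) *\<^sub>R k))" by simp
  define g where "g x = (\<alpha> x * c) *\<^sub>R k + \<beta> x *\<^sub>R w" for x
  show ?thesis
  proof
    show "linear g"
      by (rule linearI) (simp_all add: g_def \<alpha>_def \<beta>_def algebra_simps add_divide_distrib)
    show "g t = w" using u(1) by (simp add: g_def \<alpha>_def \<beta>_def)
    show "bounded (range (\<lambda>s. H (x0 + s *\<^sub>R x) - s *\<^sub>R g x))" for x
      using bounded_plus_comp[OF shift[of x] bounded_range_comp[OF along, of "\<lambda>s. s * \<alpha> x"]]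
      by (simp add: g_def algebra_simps)
  qed
qed

section \<open>Lines\<close>

definition line :: "'a::real_vector \<Rightarrow> 'a \<Rightarrow> 'a set" where
  "line x v = range (\<lambda>t. x + t *\<^sub>R v)"

lemma lineI: "x + t *\<^sub>R v \<in> line x v"
  unfolding line_def by blast

lemma base_in_line: "x \<in> line x v"
  using lineI[of x 0 v] by simp

lemma line_translate: "(+) \<tau> ` line x v = line (\<tau> + x) v"
  by (simp add: line_def image_image add.assoc)

lemma affine_line: "affine (line x v)"
proof -
  have "line x v = affine hull {x, x + v}" by (simp add: line_def affine_hull_2_alt)
  then show ?thesis by (simp only: affine_affine_hull)
qed

lemma affine_hull_eq_line:
  assumes "S \<subseteq> line x v" "\<nexists>y. S \<subseteq> {y}"
  shows "affine hull S = line x v"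
proof
  show "affine hull S \<subseteq> line x v" using assms(1) affine_line by (rule hull_minimal)
  obtain y y' where y: "y \<in> S" "y' \<in> S" "y \<noteq> y'" using assms(2) by blast
  then obtain a b where ab: "y = x + a *\<^sub>R v" "y' = x + b *\<^sub>R v"
    using assms(1) unfolding line_def by blast
  have "b - a \<noteq> 0" using ab y(3) by auto
  have "line x v \<subseteq> affine hull {y, y'}"
  proof
    fix z assume "z \<in> line x v"
    then obtain t where t: "z = x + t *\<^sub>R v" unfolding line_def by blast
    have "y' - y = (b - a) *\<^sub>R v" by (simp add: ab algebra_simps)
    then have "y + ((t - a) / (b - a)) *\<^sub>R (y' - y) = y + (t - a) *\<^sub>R v"
      using \<open>b - a \<noteq> 0\<close> by simp
    also have "\<dots> = z" by (simp add: t ab algebra_simps)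
    finally show "z \<in> affine hull {y, y'}" unfolding affine_hull_2_alt by blast
  qed
  also have "\<dots> \<subseteq> affine hull S" using y by (intro hull_mono) auto
  finally show "line x v \<subseteq> affine hull S" .
qed

lemma cross2_lines_two_common_points:
  assumes "y \<in> line x v" "y' \<in> line x v" "y \<in> line x' v'" "y' \<in> line x' v'" "y \<noteq> y'"
  shows "cross2 v v' = 0"
proof -
  obtain a b where ab: "y = x + a *\<^sub>R v" "y' = x + b *\<^sub>R v"
    using assms(1,2) unfolding line_def by blast
  obtain a' b' where ab': "y = x' + a' *\<^sub>R v'" "y' = x' + b' *\<^sub>R v'"
    using assms(3,4) unfolding line_def by blast
  have "(a - b) *\<^sub>R v = y - y'" by (simp add: ab algebra_simps)
  also have "\<dots> = (a' - b') *\<^sub>R v'" by (simp add: ab' algebra_simps)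
  finally have "(a - b) * cross2 v v' = 0" by (metis cross2_simps(5,7) mult_zero_right)
  moreover have "a \<noteq> b" using ab assms(5) by auto
  ultimately show ?thesis by simp
qed

lemma mem_vertex_lines_iff: "L \<in> vertex_lines d \<T> \<longleftrightarrow> (\<exists>x\<in>tiling_vertices \<T>. \<exists>i. L = line x (d i))"
  unfolding vertex_lines_def line_def by (auto simp: full_SetCompr_eq)

lemma mem_decoration_iff:
  "S \<in> snd (translate_decorated \<tau> (decorate d \<T> T)) \<longleftrightarrow>
    (\<exists>x\<in>tiling_vertices \<T>. \<exists>i. S = line (\<tau> + x) (d i) \<inter> (+) \<tau> ` T \<and> (\<nexists>y. S \<subseteq> {y}))"
proof -
  have image: "(+) \<tau> ` (line x v \<inter> T) = line (\<tau> + x) v \<inter> (+) \<tau> ` T" for x v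
    by (simp add: image_Int line_translate)
  have single: "(\<exists>y. (+) \<tau> ` U \<subseteq> {y}) \<longleftrightarrow> (\<exists>y. U \<subseteq> {y})" for U
  proof
    assume "\<exists>y. (+) \<tau> ` U \<subseteq> {y}"
    then obtain y where "(+) \<tau> ` U \<subseteq> {y}" ..
    then have "U \<subseteq> {y - \<tau>}" by (auto simp: algebra_simps)
    then show "\<exists>y. U \<subseteq> {y}" ..
  qed auto
  have "(S = line (\<tau> + x) v \<inter> (+) \<tau> ` T \<and> (\<nexists>y. S \<subseteq> {y})) \<longleftrightarrow>
      (S = (+) \<tau> ` (line x v \<inter> T) \<and> (\<nexists>y. line x v \<inter> T \<subseteq> {y}))" for x v
    unfolding image[symmetric] using single by metis
  then show ?thesis
    by (simp add: translate_decorated_def decorate_def) (auto simp: mem_vertex_lines_iff)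
qed

lemma fst_translate_decorated: "fst (translate_decorated \<tau> A) = (+) \<tau> ` fst A"
  by (simp add: translate_decorated_def)

lemma fst_decorate: "fst (decorate d \<T> T) = T"
  by (simp add: decorate_def)

section \<open>Ammann bars\<close>

context fine_slope
begin

definition kernel_part :: "real^4 \<Rightarrow> real^4" (\<open>\<psi>\<close>) where
  "\<psi> v = v - \<sigma> (\<pi> v)"

lemma linear_kernel_part: "linear \<psi>"
  by (rule linearI)
    (simp_all add: kernel_part_def \<pi>_simps linear_add[OF linear_slope_section]
      linear_scale[OF linear_slope_section] algebra_simps)

lemmas kernel_part_simps = linear_add[OF linear_kernel_part] linear_diff[OF linear_kernel_part]
  linear_scale[OF linear_kernel_part]

lemma obtain_kernel_part_bound:
  obtains B where "B > 0" "\<And>x. norm (\<psi> x) \<le> B * norm x"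
  using linear_bounded_pos[OF linear_kernel_part] by blast

lemma kernel_part_eq_0_iff: "\<psi> v = 0 \<longleftrightarrow> v \<in> E"
  using slope_section_mem[of "\<pi> v"] by (auto simp: kernel_part_def slope_section_\<pi>)

lemma kernel_part_axis: "\<psi> (axis i 1) = (- \<kappa> i) *\<^sub>R kernel_vec i"
  by (simp add: kernel_part_def \<pi>_axis linear_scale[OF linear_slope_section]
    slope_section_\<pi>[OF p_mem] kernel_vec_def scaleR_diff_right axis_ratio_nonzero)

lemma lattice_disjoint_slope: "m \<in> integer_lattice \<Longrightarrow> m \<in> E \<Longrightarrow> m = 0"
  using irrational Ints_subset_Rats by (auto simp: totally_irrational_def integer_lattice_def)

lemma obtain_transversal_directions:
  assumes "t \<noteq> 0"
  obtains j l where "j \<noteq> l" "cross2 (dir j) t \<noteq> 0" "cross2 (dir l) t \<noteq> 0"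
proof -
  have unique: "i = i'" if "cross2 (dir i) t = 0" "cross2 (dir i') t = 0" for i i'
  proof (rule ccontr)
    assume "i \<noteq> i'"
    from cramer2[OF dir_cross[OF this], of t] that have "t = 0"
      using cross2_commute[of "dir i'" t] by simp
    then show False using assms by simp
  qed
  show ?thesis
  proof (cases "cross2 (dir 0) t = 0")
    case True
    then show ?thesis using that[of 1 2] unique[of 0 1] unique[of 0 2] by auto
  next
    case False
    then show ?thesis using that[of 0 1] that[of 0 2] unique[of 1 2] by fastforce
  qed
qed

theorem coarse_period_eq_0:
  fixes H :: "real^2 \<Rightarrow> real^4"
  assumes "t \<noteq> 0"
    and period: "\<And>z r. norm (H (z + r *\<^sub>R t) - H z - r *\<^sub>R w) \<le> C"
    and bars: "\<And>i. \<exists>l. bounded (range (\<lambda>s. H (x0 + s *\<^sub>R dir i) - l s *\<^sub>R kernel_vec i))"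
  shows "w = 0"
proof -
  have "\<exists>l. \<forall>i. bounded (range (\<lambda>s. H (x0 + s *\<^sub>R dir i) - l i s *\<^sub>R kernel_vec i))"
    by (intro choice allI bars)
  then obtain l where l: "\<And>i. bounded (range (\<lambda>s. H (x0 + s *\<^sub>R dir i) - l i s *\<^sub>R kernel_vec i))"
    by blast
  obtain i j where ij: "i \<noteq> j" "cross2 (dir i) t \<noteq> 0" "cross2 (dir j) t \<noteq> 0"
    by (rule obtain_transversal_directions[OF assms(1)])
  obtain g where g: "linear g" "g t = w"
    and coarse: "\<And>x. bounded (range (\<lambda>s. H (x0 + s *\<^sub>R x) - s *\<^sub>R g x))"
    by (rule coarsely_linear_if_near_two_lines[OF period ij(2) l[of i] ij(3) l[of j]
          independent_pairI[OF kernel_vec_nonzero kernel_vec_pairwise_independent[OF ij(1)]]]) blast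
  have "\<exists>\<mu>. g (dir m) = \<mu> *\<^sub>R kernel_vec m" for m
    using bounded_minus_comp[OF l[of m] coarse[of "dir m"]]
    by (intro multiples_near_line_imp_collinear[of _ "l m"]) simp
  then show ?thesis using no_deformation[OF g(1)] g(2) by blast
qed

end

locale fine_tiling = fine_slope +
  fixes \<T> :: "(real^2) set set"
  assumes cut_and_project: "\<T> \<in> cut_and_project_tilings E \<pi>"
begin

lemma obtain_offset:
  obtains s where "\<And>T. T \<in> \<T> \<Longrightarrow> \<exists>x i j. x \<in> integer_lattice \<and> i \<noteq> j \<and> T = \<pi> ` two_face x i j \<and>
      two_face x i j \<subseteq> cube_thickening ((+) s ` E)"
proof -
  obtain s where "\<T> = projected_tiles ((+) s ` E) \<pi>"
    using cut_and_project by (auto simp: cut_and_project_tilings_def)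
  then show ?thesis using that unfolding projected_tiles_def selected_faces_eq by blast
qed

lemma projected_face_translate: "\<pi> ` two_face x i j = (+) (\<pi> x) ` \<pi> ` two_face 0 i j"
  using two_face_translate[of x 0 i j] by (simp add: image_image \<pi>_simps)

sublocale orig: parallelogram_tiling \<pi> \<T>
proof (rule parallelogram_tiling.intro)
  show "plane_tiling \<T>"
    using cut_and_project by (auto simp: cut_and_project_tilings_def projects_to_tiling_def)
  show "\<exists>\<tau> i j. i \<noteq> j \<and> T = (+) \<tau> ` \<pi> ` two_face 0 i j" if "T \<in> \<T>" for T
    using that projected_face_translate by (metis obtain_offset)
qed (rule linear_\<pi>, rule \<pi>_axis_cross)

lemma obtain_vertex_lift_bound:
  obtains C where "\<And>y. y \<in> tiling_vertices \<T> \<Longrightarrow> \<exists>m\<in>integer_lattice. y = \<pi> m \<and> norm (\<psi> m) \<le> C"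
proof -
  obtain s where s: "\<And>T. T \<in> \<T> \<Longrightarrow> \<exists>x i j. x \<in> integer_lattice \<and> i \<noteq> j \<and> T = \<pi> ` two_face x i j \<and>
      two_face x i j \<subseteq> cube_thickening ((+) s ` E)"
    by (rule obtain_offset) blast
  obtain B where B: "B > 0" "\<And>x. norm (\<psi> x) \<le> B * norm x"
    by (rule obtain_kernel_part_bound) blast
  have "\<exists>m\<in>integer_lattice. y = \<pi> m \<and> norm (\<psi> m) \<le> norm (\<psi> s) + B * 4"
    if y: "y \<in> tiling_vertices \<T>" for y
  proof -
    obtain T where T: "T \<in> \<T>" "y extreme_point_of T" using y by (auto simp: tiling_vertices_def)
    obtain x i j where x: "x \<in> integer_lattice" "T = \<pi> ` two_face x i j"
      "two_face x i j \<subseteq> cube_thickening ((+) s ` E)" using s[OF T(1)] by blast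
    obtain m where m: "m \<in> face_corners x i j" "y = \<pi> m"
      using extreme_point_of_projected_face[OF linear_\<pi>, of y 0 x i j] T(2) x(2) by auto
    have "m \<in> cube_thickening ((+) s ` E)"
      using m(1) x(3) face_corners_subset_two_face by blast
    then obtain e c where e: "m = s + e + c" "e \<in> E" "c \<in> unit_cube"
      unfolding cube_thickening_def by blast
    then have "\<psi> m = \<psi> s + \<psi> c" by (simp add: kernel_part_simps kernel_part_eq_0_iff[THEN iffD2])
    moreover have "norm (\<psi> c) \<le> B * 4"
      using B(2)[of c] mult_left_mono[OF norm_unit_cube[OF e(3)], of B] B(1) by linarith
    ultimately have "norm (\<psi> m) \<le> norm (\<psi> s) + B * 4" by (simp add: norm_triangle_le)
    then show ?thesis using m face_corners_integral[OF x(1)] by blast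
  qed
  then show ?thesis by (rule that)
qed

lemma ammann_bar_rule_decorate: "ammann_bar_rule (decorate dir \<T> ` \<T>)"
  unfolding ammann_bar_rule_def
proof (intro ballI)
  have segment: "S \<in> snd (decorate dir \<T> T) \<longleftrightarrow>
    (\<exists>x\<in>tiling_vertices \<T>. \<exists>i. S = line x (dir i) \<inter> T \<and> (\<nexists>y. S \<subseteq> {y}))" for S T
    using mem_decoration_iff[of S 0 dir \<T> T] by (simp add: translate_decorated_def)
  fix A S assume "A \<in> decorate dir \<T> ` \<T>" "S \<in> snd A"
  then obtain T where "S \<in> snd (decorate dir \<T> T)" by blast
  then obtain x i where x: "x \<in> tiling_vertices \<T>" and S: "S = line x (dir i) \<inter> T" "\<nexists>y. S \<subseteq> {y}"
    unfolding segment by blast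
  have hull: "affine hull S = line x (dir i)"
    using S by (intro affine_hull_eq_line) auto
  show "affine hull S = \<Union>{S'. (\<exists>B\<in>decorate dir \<T> ` \<T>. S' \<in> snd B) \<and> S' \<subseteq> affine hull S}"
  proof (intro equalityI subsetI)
    fix z assume "z \<in> affine hull S"
    then have z: "z \<in> line x (dir i)" by (simp only: hull)
    obtain T' r where T': "T' \<in> \<T>" "z \<in> T'" "r \<noteq> 0" "z + r *\<^sub>R dir i \<in> T'"
      using orig.tile_in_direction[OF dir_nonzero] by metis
    have "z + r *\<^sub>R dir i \<in> line x (dir i)"
      using z unfolding line_def by (auto simp: add.assoc simp flip: scaleR_add_left)
    moreover have "z + r *\<^sub>R dir i \<noteq> z" using T'(3) dir_nonzero by simp
    ultimately have "\<nexists>y. line x (dir i) \<inter> T' \<subseteq> {y}" using T' z by blast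
    then have "line x (dir i) \<inter> T' \<in> snd (decorate dir \<T> T')" unfolding segment using x by blast
    then show "z \<in> \<Union>{S'. (\<exists>B\<in>decorate dir \<T> ` \<T>. S' \<in> snd B) \<and> S' \<subseteq> affine hull S}"
      using T'(1,2) z unfolding hull by blast
  qed blast
qed

theorem decorated_tiling_decorate: "decorated_tiling (FP_tileset p \<pi> \<T>) (decorate dir \<T> ` \<T>)"
proof -
  have "translate_decorated 0 A = A" for A by (simp add: translate_decorated_def)
  moreover have "inj_on fst (decorate dir \<T> ` \<T>)" by (auto simp: inj_on_def fst_decorate)
  moreover have "fst ` decorate dir \<T> ` \<T> = \<T>" by (simp add: image_image fst_decorate)
  ultimately show ?thesis
    using orig.plane_tiling ammann_bar_rule_decorate
    unfolding decorated_tiling_def FP_tileset_def by metis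
qed

end

locale decorated_fine_tiling = fine_tiling +
  fixes \<D> :: "decorated_tile set"
  assumes decorated: "decorated_tiling (FP_tileset p \<pi> \<T>) \<D>"
begin

lemma decorated_tileE:
  assumes "A \<in> \<D>"
  obtains T \<tau> where "T \<in> \<T>" "A = translate_decorated \<tau> (decorate dir \<T> T)" "fst A = (+) \<tau> ` T"
proof -
  obtain T \<tau> where "T \<in> \<T>" "A = translate_decorated \<tau> (decorate dir \<T> T)"
    using decorated assms unfolding decorated_tiling_def FP_tileset_def by blast
  then show ?thesis using that by (simp add: fst_translate_decorated fst_decorate)
qed

sublocale parallelogram_tiling \<pi> "fst ` \<D>"
proof (rule parallelogram_tiling.intro)
  show "plane_tiling (fst ` \<D>)" using decorated by (simp add: decorated_tiling_def)
  show "\<exists>\<tau> i j. i \<noteq> j \<and> A = (+) \<tau> ` \<pi> ` two_face 0 i j" if A: "A \<in> fst ` \<D>" for A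
  proof -
    obtain T \<tau> where T: "T \<in> \<T>" "A = (+) \<tau> ` T" using A by (auto elim: decorated_tileE)
    then obtain \<tau>' i j where "i \<noteq> j" "T = (+) \<tau>' ` \<pi> ` two_face 0 i j" using orig.tiles by blast
    then have "i \<noteq> j" "A = (+) (\<tau> + \<tau>') ` \<pi> ` two_face 0 i j"
      using T(2) by (simp_all add: image_image add.assoc)
    then show ?thesis by blast
  qed
qed (rule linear_\<pi>, rule \<pi>_axis_cross)

lemma extreme_point_translate_vertex:
  assumes "T \<in> \<T>" "y extreme_point_of (+) \<tau> ` T"
  shows "y - \<tau> \<in> tiling_vertices \<T>"
proof -
  have "\<tau> + (y - \<tau>) extreme_point_of (+) \<tau> ` T" using assms(2) by simp
  then have "y - \<tau> extreme_point_of T" by (simp only: extreme_point_of_translation_eq)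
  then show ?thesis using assms(1) by (auto simp: tiling_vertices_def)
qed

lemma bar_segment_at_vertex:
  assumes "x \<in> tiling_vertices (fst ` \<D>)"
  obtains A S where "A \<in> \<D>" "S \<in> snd A" "affine hull S = line x (dir i)"
proof -
  obtain B where B: "B \<in> fst ` \<D>" "x extreme_point_of B"
    using assms by (auto simp: tiling_vertices_def)
  obtain A' r where A': "A' \<in> fst ` \<D>" "x \<in> A'" "r \<noteq> 0" "x + r *\<^sub>R dir i \<in> A'"
    using tile_in_direction[OF dir_nonzero] by metis
  have ext: "x extreme_point_of A'"
    by (rule extreme_point_of_adjacent_tile[OF B(1) A'(1) B(2) A'(2)])
  obtain A where A: "A \<in> \<D>" "fst A = A'" using A'(1) by blast
  obtain T \<tau> where T: "T \<in> \<T>" "A = translate_decorated \<tau> (decorate dir \<T> T)" "fst A = (+) \<tau> ` T"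
    by (rule decorated_tileE[OF A(1)])
  let ?S = "line x (dir i) \<inter> (+) \<tau> ` T"
  have "x \<in> ?S" "x + r *\<^sub>R dir i \<in> ?S"
    using A(2) A' T(3) base_in_line lineI by auto
  moreover have "x + r *\<^sub>R dir i \<noteq> x" using A'(3) dir_nonzero by simp
  ultimately have not_single: "\<nexists>y. ?S \<subseteq> {y}" by blast
  have "x - \<tau> \<in> tiling_vertices \<T>"
    using extreme_point_translate_vertex[OF T(1)] ext A(2) T(3) by simp
  moreover have "?S = line (\<tau> + (x - \<tau>)) (dir i) \<inter> (+) \<tau> ` T" by simp
  ultimately have "?S \<in> snd A"
    using not_single unfolding T(2) mem_decoration_iff by blast
  moreover have "affine hull ?S = line x (dir i)"
    using not_single by (intro affine_hull_eq_line) auto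
  ultimately show ?thesis using that A(1) by blast
qed

lemma segment_on_bar:
  assumes A: "A \<in> \<D>" and S: "S \<in> snd A" "S \<subseteq> line x (dir i)"
  obtains T \<tau> x' where "T \<in> \<T>" "fst A = (+) \<tau> ` T" "S \<subseteq> fst A"
    "x' \<in> tiling_vertices \<T>" "\<tau> + x' \<in> line x (dir i)"
proof -
  obtain T \<tau> where T: "T \<in> \<T>" "A = translate_decorated \<tau> (decorate dir \<T> T)" "fst A = (+) \<tau> ` T"
    by (rule decorated_tileE[OF A])
  obtain x' j where x': "x' \<in> tiling_vertices \<T>"
    and S_eq: "S = line (\<tau> + x') (dir j) \<inter> (+) \<tau> ` T" "\<nexists>y. S \<subseteq> {y}"
    using S(1) unfolding T(2) mem_decoration_iff by blast
  obtain y y' where y: "y \<in> S" "y' \<in> S" "y \<noteq> y'" using S_eq(2) by blast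
  have "cross2 (dir i) (dir j) = 0"
    using y S(2) S_eq(1) by (intro cross2_lines_two_common_points[of y x _ y' "\<tau> + x'"]) auto
  then have "j = i" using dir_cross by metis
  have "affine hull S = line (\<tau> + x') (dir j)"
    using S_eq by (intro affine_hull_eq_line) auto
  then have "\<tau> + x' \<in> line x (dir i)"
    using affine_hull_eq_line[OF S(2) S_eq(2)] base_in_line by metis
  then show ?thesis using that T x' S_eq(1) by blast
qed

lemma bar_through_vertex:
  assumes "x \<in> tiling_vertices (fst ` \<D>)"
  obtains T \<tau> x' u where "T \<in> \<T>" "(+) \<tau> ` T \<in> fst ` \<D>" "x + r *\<^sub>R dir i \<in> (+) \<tau> ` T"
    "x' \<in> tiling_vertices \<T>" "\<tau> + x' = x + u *\<^sub>R dir i"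
proof -
  obtain A S where A: "A \<in> \<D>" "S \<in> snd A" and hull: "affine hull S = line x (dir i)"
    by (rule bar_segment_at_vertex[OF assms])
  have "ammann_bar_rule \<D>" using decorated by (simp add: decorated_tiling_def)
  then have "line x (dir i) = \<Union>{S'. (\<exists>B\<in>\<D>. S' \<in> snd B) \<and> S' \<subseteq> line x (dir i)}"
    using A unfolding ammann_bar_rule_def hull[symmetric] by blast
  then obtain B S' where B: "B \<in> \<D>" "S' \<in> snd B" "S' \<subseteq> line x (dir i)" "x + r *\<^sub>R dir i \<in> S'"
    using lineI by blast
  obtain T \<tau> x' where T: "T \<in> \<T>" "fst B = (+) \<tau> ` T" "S' \<subseteq> fst B"
    and x': "x' \<in> tiling_vertices \<T>" "\<tau> + x' \<in> line x (dir i)"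
    by (rule segment_on_bar[OF B(1-3)])
  obtain u where "\<tau> + x' = x + u *\<^sub>R dir i" using x'(2) unfolding line_def by blast
  moreover have "(+) \<tau> ` T \<in> fst ` \<D>" using B(1) T(2) by (metis imageI)
  moreover have "x + r *\<^sub>R dir i \<in> (+) \<tau> ` T" using B(4) T(2,3) by blast
  ultimately show ?thesis using that T(1) x'(1) by blast
qed

end

locale based_decorated_fine_tiling = decorated_fine_tiling +
  fixes x0 :: "real^2"
  assumes base_vertex: "x0 \<in> tiling_vertices (fst ` \<D>)"
begin

sublocale lifted_tiling \<pi> "fst ` \<D>" x0
  by unfold_locales (use lattice_kernel_trivial base_vertex in auto)

lemma kernel_part_point_lift_near:
  obtains C where "\<And>A z y. A \<in> fst ` \<D> \<Longrightarrow> z \<in> A \<Longrightarrow> y extreme_point_of A \<Longrightarrow>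
    norm (\<psi> (point_lift z) - \<psi> (lift y)) \<le> C"
proof -
  obtain B where B: "B > 0" "\<And>x. norm (\<psi> x) \<le> B * norm x"
    by (rule obtain_kernel_part_bound) blast
  have "norm (\<psi> (point_lift z) - \<psi> (lift y)) \<le> B * 8"
    if "A \<in> fst ` \<D>" "z \<in> A" "y extreme_point_of A" for A z y
  proof -
    have "norm (\<psi> (point_lift z - lift y)) \<le> B * norm (point_lift z - lift y)" by (rule B(2))
    also have "\<dots> \<le> B * 8"
      using point_lift_near[OF that] B(1) by (intro mult_left_mono) (auto simp: dist_norm)
    finally show ?thesis by (simp add: kernel_part_simps)
  qed
  then show ?thesis by (rule that)
qed

lemma kernel_part_lift_along_bar:
  assumes y: "y \<in> tiling_vertices (fst ` \<D>)" and n: "n \<in> integer_lattice"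
    and along: "y = x0 + u *\<^sub>R dir i + \<pi> n"
  obtains l where "\<psi> (lift y) = l *\<^sub>R kernel_vec i + \<psi> n"
proof -
  have "x0 + \<pi> (lift y) = x0 + u *\<^sub>R dir i + \<pi> n"
    using lift(2)[OF y] along by simp
  then have parallel: "cross2 (dir i) (\<pi> (lift y - n)) = 0" by (simp add: \<pi>_simps)
  have "lift y - n \<in> integer_lattice" using lift(1)[OF y] n by (rule integer_lattice_diff)
  then obtain \<rho> c where "lift y - n = \<rho> *\<^sub>R p i + c *\<^sub>R axis i 1"
    using parallel by (rule lattice_projection_parallel)
  then have "\<psi> (lift y - n) = (- c * \<kappa> i) *\<^sub>R kernel_vec i"
    by (simp add: kernel_part_simps(1,3) kernel_part_axis
      kernel_part_eq_0_iff[THEN iffD2, OF p_mem])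
  then have "\<psi> (lift y) = (- c * \<kappa> i) *\<^sub>R kernel_vec i + \<psi> n"
    by (simp add: kernel_part_simps algebra_simps)
  then show ?thesis by (rule that)
qed

text \<open>The lifts of the vertices of a single tile of \<open>\<T>\<close> stay near \<open>E\<close>, so \<open>\<psi>\<close> only sees the lattice
  vector by which the tile is displaced along the bar.\<close>

theorem kernel_part_point_lift_along_bar:
  "\<exists>l. bounded (range (\<lambda>r. \<psi> (point_lift (x0 + r *\<^sub>R dir i)) - l r *\<^sub>R kernel_vec i))"
proof -
  obtain C where lift_near: "\<And>A z y. A \<in> fst ` \<D> \<Longrightarrow> z \<in> A \<Longrightarrow> y extreme_point_of A \<Longrightarrow>
      norm (\<psi> (point_lift z) - \<psi> (lift y)) \<le> C"
    by (rule kernel_part_point_lift_near) blast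
  obtain C' where vertices_near: "\<And>y. y \<in> tiling_vertices \<T> \<Longrightarrow>
      \<exists>m\<in>integer_lattice. y = \<pi> m \<and> norm (\<psi> m) \<le> C'"
    by (rule obtain_vertex_lift_bound) blast
  have "\<exists>l. norm (\<psi> (point_lift (x0 + r *\<^sub>R dir i)) - l *\<^sub>R kernel_vec i) \<le> C + (C' + C')" for r
  proof -
    obtain T \<tau> x' u where T: "T \<in> \<T>" "(+) \<tau> ` T \<in> fst ` \<D>" "x0 + r *\<^sub>R dir i \<in> (+) \<tau> ` T"
      and x': "x' \<in> tiling_vertices \<T>" "\<tau> + x' = x0 + u *\<^sub>R dir i"
      by (rule bar_through_vertex[OF base_vertex])
    obtain y where y: "y extreme_point_of (+) \<tau> ` T" using ex_extreme_point[OF T(2)] by blast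
    obtain m where m: "m \<in> integer_lattice" "y - \<tau> = \<pi> m" "norm (\<psi> m) \<le> C'"
      using vertices_near extreme_point_translate_vertex[OF T(1) y] by blast
    obtain m' where m': "m' \<in> integer_lattice" "x' = \<pi> m'" "norm (\<psi> m') \<le> C'"
      using vertices_near x'(1) by blast
    have "y = (\<tau> + x') + ((y - \<tau>) - x')" by simp
    also have "\<dots> = x0 + u *\<^sub>R dir i + \<pi> (m - m')"
      using x'(2) m(2) m'(2) by (simp add: \<pi>_simps)
    finally obtain l where "\<psi> (lift y) = l *\<^sub>R kernel_vec i + \<psi> (m - m')"
      by (rule kernel_part_lift_along_bar[OF extreme_point_is_vertex[OF T(2) y]
            integer_lattice_diff[OF m(1) m'(1)]])
    then have "\<psi> (point_lift (x0 + r *\<^sub>R dir i)) - l *\<^sub>R kernel_vec i =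
        (\<psi> (point_lift (x0 + r *\<^sub>R dir i)) - \<psi> (lift y)) + (\<psi> m - \<psi> m')"
      by (simp add: kernel_part_simps)
    also have "norm \<dots> \<le> C + (C' + C')"
      by (intro norm_triangle_le norm_triangle_le_diff add_mono lift_near[OF T(2,3) y] m(3) m'(3))
    finally show ?thesis by blast
  qed
  then have "\<exists>l. \<forall>r. norm (\<psi> (point_lift (x0 + r *\<^sub>R dir i)) - l r *\<^sub>R kernel_vec i) \<le> C + (C' + C')"
    by (intro choice allI)
  then show ?thesis unfolding bounded_iff by blast
qed

lemma period_eq_0:
  assumes "translation_invariant t (fst ` \<D>)"
  shows "t = 0"
proof (rule ccontr)
  assume "t \<noteq> 0"
  obtain A where A: "A \<in> fst ` \<D>" "x0 extreme_point_of A"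
    using base_vertex by (auto simp: tiling_vertices_def)
  then have "t + x0 extreme_point_of (+) t ` A" by (simp add: extreme_point_of_translation_eq)
  then have "t + x0 \<in> tiling_vertices (fst ` \<D>)"
    using extreme_point_is_vertex translation_invariantD[OF assms A(1)] by blast
  then obtain q where q: "q \<in> integer_lattice" "t + x0 = x0 + \<pi> q"
    using ex_lattice_coordinates by blast
  then have t: "t = \<pi> q" by simp
  have "q \<noteq> 0" using t \<open>t \<noteq> 0\<close> by (auto simp: \<pi>_simps)
  obtain C where C: "\<And>z r. norm (point_lift (z + r *\<^sub>R \<pi> q) - point_lift z - r *\<^sub>R q) \<le> C"
    using point_lift_coarsely_equivariant[OF assms[unfolded t] q(1)] by blast
  obtain B where B: "B > 0" "\<And>x. norm (\<psi> x) \<le> B * norm x"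
    by (rule obtain_kernel_part_bound) blast
  have "\<psi> q = 0"
  proof (rule coarse_period_eq_0[OF \<open>t \<noteq> 0\<close> _ kernel_part_point_lift_along_bar])
    fix z r
    have "\<psi> (point_lift (z + r *\<^sub>R t)) - \<psi> (point_lift z) - r *\<^sub>R \<psi> q =
        \<psi> (point_lift (z + r *\<^sub>R \<pi> q) - point_lift z - r *\<^sub>R q)"
      by (simp add: kernel_part_simps t)
    also have "norm \<dots> \<le> B * C"
      using B(1) by (intro order_trans[OF B(2) mult_left_mono[OF C]]) simp
    finally show "norm (\<psi> (point_lift (z + r *\<^sub>R t)) - \<psi> (point_lift z) - r *\<^sub>R \<psi> q) \<le> B * C" .
  qed
  then show False
    using lattice_disjoint_slope[OF q(1)] \<open>q \<noteq> 0\<close> by (simp add: kernel_part_eq_0_iff)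
qed

end

theorem (in decorated_fine_tiling) not_periodic: "\<not> periodic \<D>"
proof
  assume "periodic \<D>"
  then obtain t where t: "t \<noteq> 0" "translate_decorated t ` \<D> = \<D>" by (auto simp: periodic_def)
  obtain A x0 where "A \<in> fst ` \<D>" "x0 extreme_point_of A" using cover ex_extreme_point by metis
  then interpret based_decorated_fine_tiling E p \<pi> \<T> \<D> x0
    by unfold_locales (auto simp: tiling_vertices_def)
  have "(\<lambda>A. (+) t ` A) ` fst ` \<D> = fst ` translate_decorated t ` \<D>"
    by (simp add: image_image fst_translate_decorated)
  then have "t = 0" using t(2) by (intro period_eq_0) (simp add: translation_invariant_def)
  then show False using t(1) by simp
qed

theorem theorem1:
  fixes E :: "(real^4) set"
    and p :: "4 \<Rightarrow> real^4"
    and \<pi> :: "real^4 \<Rightarrow> real^2"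
    and \<T> :: "(real^2) set set"
  assumes "two_plane E"
    and "totally_irrational E"
    and "characterized_by_subperiods E p"
    and "fine_projection E p \<pi>"
    and "\<T> \<in> cut_and_project_tilings E \<pi>"
  shows "aperiodic_tileset (FP_tileset p \<pi> \<T>)"
proof -
  interpret fine_tiling E p \<pi> \<T>
    using assms by unfold_locales
  have "\<not> periodic \<D>" if "decorated_tiling (FP_tileset p \<pi> \<T>) \<D>" for \<D>
  proof -
    interpret decorated_fine_tiling E p \<pi> \<T> \<D>
      using that by unfold_locales
    show ?thesis by (rule not_periodic)
  qed
  then show ?thesis
    unfolding aperiodic_tileset_def using decorated_tiling_decorate by blast
qed

end
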